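(* Let $t$ be a nonnegative integer (independent of $n$), let $f_0,\dots,f_t\in L^1([-\pi,\pi])$ be complex-valued functions, and let $(c_n^{(j)})_n$, $j=0,\dots,t$, be sequences of nonzero scalars such that $c_n^{(0)}=1$ for all $n$ and $c_n^{(s)}=o(c_n^{(r)})$ as $n\to\infty$ whenever $t\ge s>r\ge 0$. Let $\{A_n^{(j)}\}_n$, $j=0,\dots,t$, be matrix sequences with $A_n^{(j)}\in\mathbb{C}^{n\times n}$ and $$\frac{A_n^{(j)}}{c_n^{(j)}}=T_n(f_j)\quad\text{for all } n \text{ and all } j=0,\dots,t,$$ and let $\{X_n\}_n$ be the matrix sequence defined by $$X_n=A_n^{(0)}+\sum_{j=1}^t A_n^{(j)} .$$ Define $$f_n^{\mathrm{mom}}=f_0+\sum_{j=1}^t c_n^{(j)}f_j .$$ Then $\{X_n\}_n$ is a GLT matrix sequence and the generating function $f_0$ of the main term $A_n^{(0)}=T_n(f_0)$ is its GLT symbol, that is, $\{X_n\}_n\sim_{\mathrm{GLT}} f_0$. Furthermore, $\lim_{n\to\infty} f_n^{\mathrm{mom}}=f_0$ uniformly on the domain of definition $[-\pi,\pi]$.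
   Context: Toeplitz matrices: for $f\in L^1([-\pi,\pi])$, $T_n(f)=[\hat f_{i-j}]_{i,j=1}^n\in\mathbb{C}^{n\times n}$, where $\hat f_k=\frac1{2\pi}\int_{-\pi}^{\pi}f(\theta)e^{-k\mathbf{i}\theta}\,d\theta$, $k\in\mathbb{Z}$, $\mathbf{i}^2=-1$. The function $f_n^{\mathrm{mom}}$ is called the Toeplitz momentary symbol of $X_n$, and $\{f_n^{\mathrm{mom}}\}_n$ is the sequence of Toeplitz momentary symbols of $\{X_n\}_n$. Matrix sequences: $\{A_n\}_n$ denotes a sequence with $A_n\in\mathbb{C}^{n\times n}$; operations on sequences are performed termwise in $n$. Singular value distribution: for a measurable $f:G\to\mathbb{C}$ with $G\subset\mathbb{R}^\ell$ measurable, $0<\mu_\ell(G)<\infty$, one writes $\{A_n\}_n\sim_\sigma (f,G)$ if for every continuous compactly supported $F$ on $[0,\infty)$, $\lim_{n\to\infty}\frac1n\sum_{j=1}^nF(\sigma_j(A_n))=\frac1{\mu_\ell(G)}\int_GF(|f(\boldsymbol\theta)|)\,d\boldsymbol\theta$, where $\sigma_j(A_n)$ are the singular values. Eigenvalue distribution is defined analogously with the eigenvalues $\lambda_j(A_n)$, continuous compactly supported $F$ on $\mathbb{C}$, and $F(f(\boldsymbol\theta))$ in the integral. GLT sequences: $\{A_n\}_n\sim_{\mathrm{GLT}}\kappa$ is the relation "$\{A_n\}_n$ is a Generalized Locally Toeplitz (GLT) sequence with symbol $\kappa$" of the standard GLT theory (scalar unilevel case). In general $\kappa$ is a measurable function on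 $[0,1]\times[-\pi,\pi]$; a symbol depending only on $\theta\in[-\pi,\pi]$ is regarded as constant in the first variable. The GLT class is characterized by the following axioms. (GLT1) If $\{A_n\}_n\sim_{\mathrm{GLT}}\kappa$ then $\kappa$ is a singular value symbol of $\{A_n\}_n$; if the $A_n$ are Hermitian then the distribution also holds in the eigenvalue sense. (GLT2) GLT sequences form a $*$-algebra: they are closed under linear combinations, products, inversion (whenever the symbol vanishes at most on a set of zero Lebesgue measure) and conjugation, and the symbol of a sequence obtained by such operations from finitely many GLT sequences is obtained by performing the same operations on their symbols. (GLT3) For $f\in L^1([-\pi,\pi])$, $\{T_n(f)\}_n\sim_{\mathrm{GLT}}f(\theta)$; for $a:[0,1]\to\mathbb{C}$ Riemann-integrable, the diagonal sampling sequence $D_n(a)=\mathrm{diag}(a(i/n))_{i=1}^n$ satisfies $\{D_n(a)\}_n\sim_{\mathrm{GLT}}a(x)$. (GLT4) Every sequence distributed as the constant $0$ in the singular value sense is a GLT sequence with symbol $0$; in particular every sequence whose rank divided by the size tends to zero, and every sequence whose trace-norm (sum of the singular values) divided by the size tends to zero, as the size tends to infinity.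
   Formalization: Uniform convergence of f_n^mom to f_0 on all of [-π,π] fails for unbounded f_j (e.g. f_0=0, f_1=|θ|^{-1/2}, c_n^{(1)}=1/(n+1)); it is proved on every subset of [-π,π] where f_1,…,f_t are bounded, so on the whole interval if they are bounded. *)

theory Defs
  imports
    "HOL-Analysis.Analysis"
    "HOL-Library.Landau_Symbols"
    "Jordan_Normal_Form.DL_Rank"
begin

text \<open>
  Functions on \<open>[-\<pi>, \<pi>]\<close> or \<open>[0,1] \<times> [-\<pi>, \<pi>]\<close> are total functions of which only the values on
  that domain matter. \<open>f \<in> L\<^sup>1([-\<pi>, \<pi>])\<close> is \<open>f absolutely_integrable_on {-pi..pi}\<close>, that is,
  Lebesgue integrability. A matrix sequence is a function \<open>A\<close> on \<open>nat\<close> with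
  \<open>A n \<in> carrier_mat n n\<close>; its term for \<open>n = 0\<close> is the empty matrix.
\<close>

definition fourier_coeff :: "(real \<Rightarrow> complex) \<Rightarrow> int \<Rightarrow> complex" where
  "fourier_coeff f k =
     1 / (2 * of_real pi) *
       (LINT \<theta>:{-pi..pi}|lebesgue. f \<theta> * exp (- (of_int k * \<i> * of_real \<theta>)))"

definition toeplitz :: "nat \<Rightarrow> (real \<Rightarrow> complex) \<Rightarrow> complex mat" where
  "toeplitz n f = mat n n (\<lambda>(i, j). fourier_coeff f (int i - int j))"

definition mat_sum :: "nat \<Rightarrow> ('i \<Rightarrow> complex mat) \<Rightarrow> 'i set \<Rightarrow> complex mat" where
  "mat_sum n B I = mat n n (\<lambda>(r, s). \<Sum>i\<in>I. B i $$ (r, s))"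

text \<open>
  Convergence of the momentary symbols: for an unbounded \<open>f j \<in> L\<^sup>1\<close> such as \<open>\<bar>\<theta>\<bar> powr (-1/2)\<close> and
  \<open>c j n \<noteq> 0\<close>, the function \<open>c j n * f j\<close> is unbounded for every \<open>n\<close>, so uniform convergence on all
  of \<open>[-\<pi>, \<pi>]\<close> fails. It can only be asserted on sets \<open>S\<close> on which \<open>f 1, \<dots>, f t\<close> are bounded;
  \<open>S\<close> is the whole interval if these functions are bounded.
\<close>

definition toeplitz_momentary_symbol ::
    "nat \<Rightarrow> (nat \<Rightarrow> nat \<Rightarrow> complex) \<Rightarrow> (nat \<Rightarrow> real \<Rightarrow> complex) \<Rightarrow> nat \<Rightarrow> real \<Rightarrow> complex" where
  "toeplitz_momentary_symbol t c f n \<theta> = f 0 \<theta> + (\<Sum>j = 1..t. c j n * f j \<theta>)"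

definition l2_norm_vec :: "complex vec \<Rightarrow> real" where
  "l2_norm_vec v = L2_set (\<lambda>i. cmod (vec_index v i)) {..<dim_vec v}"

text \<open>The operator norm induced by the Euclidean norm; meaningful for matrices with at least
  one column.\<close>

definition spectral_norm :: "complex mat \<Rightarrow> real" where
  "spectral_norm A =
     (SUP v \<in> {v \<in> carrier_vec (dim_col A). l2_norm_vec v = 1}. l2_norm_vec (A *\<^sub>v v))"

text \<open>
  Generalized Locally Toeplitz sequences are defined as in the monograph of Garoni and
  Serra-Capizzano, \<open>Generalized Locally Toeplitz Sequences: Theory and Applications\<close>, vol. I:
  via approximating classes of sequences, locally Toeplitz sequences and convergence in measure.
  In \<open>acs B A\<close> the sequence \<open>n \<mapsto> B m n\<close> is the \<open>m\<close>-th approximant of \<open>A\<close>.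
\<close>

definition acs :: "(nat \<Rightarrow> nat \<Rightarrow> complex mat) \<Rightarrow> (nat \<Rightarrow> complex mat) \<Rightarrow> bool" where
  "acs B A \<longleftrightarrow>
     (\<exists>(n\<^sub>0 :: nat \<Rightarrow> nat) (c :: nat \<Rightarrow> real) (\<omega> :: nat \<Rightarrow> real).
        c \<longlonglongrightarrow> 0 \<and> \<omega> \<longlonglongrightarrow> 0 \<and>
        (\<forall>m. \<forall>n \<ge> n\<^sub>0 m. n > 0 \<longrightarrow>
           (\<exists>R \<in> carrier_mat n n. \<exists>N \<in> carrier_mat n n.
              A n = B m n + R + N \<and>
              real (vec_space.rank n R) \<le> c m * real n \<and>
              spectral_norm N \<le> \<omega> m)))"

text \<open>Riemann integrability (as opposed to the gauge integral of the library): the mesh of the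
  tagged divisions is controlled by a constant \<open>\<delta>\<close>.\<close>

definition riemann_integrable_01 :: "(real \<Rightarrow> complex) \<Rightarrow> bool" where
  "riemann_integrable_01 a \<longleftrightarrow>
     (\<exists>I. \<forall>\<epsilon>>0. \<exists>\<delta>>0. \<forall>p. p tagged_division_of cbox 0 1 \<and> (\<lambda>x. ball x \<delta>) fine p \<longrightarrow>
        cmod ((\<Sum>(x, K)\<in>p. Henstock_Kurzweil_Integration.content K *\<^sub>R a x) - I) < \<epsilon>)"

text \<open>The locally Toeplitz operator
  \<open>LT\<^sub>n\<^sup>m(a, f) = (D\<^sub>m(a) \<otimes> T\<^bsub>n div m\<^esub>(f)) \<oplus> O\<^bsub>n mod m\<^esub>\<close>.\<close>

definition lt_operator ::
    "nat \<Rightarrow> nat \<Rightarrow> (real \<Rightarrow> complex) \<Rightarrow> (real \<Rightarrow> complex) \<Rightarrow> complex mat" where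
  "lt_operator n m a f =
     diag_block_mat
       (map (\<lambda>i. a (real i / real m) \<cdot>\<^sub>m toeplitz (n div m) f) [1..<Suc m] @
        [0\<^sub>m (n mod m) (n mod m)])"

definition locally_toeplitz ::
    "(nat \<Rightarrow> complex mat) \<Rightarrow> (real \<Rightarrow> complex) \<Rightarrow> (real \<Rightarrow> complex) \<Rightarrow> bool" where
  "locally_toeplitz A a f \<longleftrightarrow>
     (\<forall>n. A n \<in> carrier_mat n n) \<and>
     riemann_integrable_01 a \<and> f absolutely_integrable_on {-pi..pi} \<and>
     acs (\<lambda>m n. lt_operator n m a f) A"

abbreviation glt_domain :: "(real \<times> real) set" where
  "glt_domain \<equiv> {0..1} \<times> {-pi..pi}"

definition converges_in_measure_on ::
    "(real \<times> real) set \<Rightarrow> (nat \<Rightarrow> real \<times> real \<Rightarrow> complex) \<Rightarrow> (real \<times> real \<Rightarrow> complex) \<Rightarrow> bool" where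
  "converges_in_measure_on Q \<kappa>s \<kappa> \<longleftrightarrow>
     (\<forall>\<epsilon>>0. (\<lambda>m. measure lebesgue {p \<in> Q. cmod (\<kappa>s m p - \<kappa> p) > \<epsilon>}) \<longlonglongrightarrow> 0)"

definition glt_sequence :: "(nat \<Rightarrow> complex mat) \<Rightarrow> (real \<times> real \<Rightarrow> complex) \<Rightarrow> bool" where
  "glt_sequence A \<kappa> \<longleftrightarrow>
     (\<forall>n. A n \<in> carrier_mat n n) \<and>
     \<kappa> \<in> borel_measurable (lebesgue_on glt_domain) \<and>
     (\<exists>(N :: nat \<Rightarrow> nat) (B :: nat \<Rightarrow> nat \<Rightarrow> nat \<Rightarrow> complex mat)
         (a :: nat \<Rightarrow> nat \<Rightarrow> real \<Rightarrow> complex) (f :: nat \<Rightarrow> nat \<Rightarrow> real \<Rightarrow> complex).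
        (\<forall>m. \<forall>i<N m. locally_toeplitz (B m i) (a m i) (f m i)) \<and>
        converges_in_measure_on glt_domain (\<lambda>m (x, \<theta>). \<Sum>i<N m. a m i x * f m i \<theta>) \<kappa> \<and>
        acs (\<lambda>m n. mat_sum n (\<lambda>i. B m i n) {..<N m}) A)"

end

theory Submission
  imports Defs
begin

text \<open>
  Linearity of Fourier coefficients gives \<open>X n = T\<^sub>n(f 0 + h n)\<close>, where the perturbation
  \<open>h n = (\<Sum>j = 1..t. c j n * f j)\<close> tends to zero in \<open>L\<^sup>1\<close> because \<open>c j n \<longlonglongrightarrow> 0\<close> for \<open>j \<ge> 1\<close>.
  It turns out that \<open>X\<close> itself is a locally Toeplitz sequence with symbol \<open>1 \<otimes> f 0\<close>, so that a
  single summand, the same for every \<open>m\<close>, witnesses the GLT property and the convergence in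
  measure is trivial.  What remains is to write \<open>T\<^sub>n(f 0 + h n)\<close>, for fixed \<open>m\<close> and large \<open>n\<close>, as
  \<open>LT\<^sub>n\<^sup>m(1, f 0)\<close> plus a matrix of rank at most \<open>\<epsilon> n\<close> plus a matrix of spectral norm at most
  \<open>\<epsilon>\<close>, with \<open>\<epsilon> = 1 / (m + 1)\<close>.

  To this end \<open>f 0\<close> is split as \<open>g + u\<close> with \<open>g\<close> bounded and \<open>u\<close> small in \<open>L\<^sup>1\<close>, and the
  difference is treated by two estimates.

  For the bounded part, \<open>T\<^sub>n(g) - LT\<^sub>n\<^sup>m(1, g)\<close> consists of the entries outside the diagonal
  blocks.  Those close to the diagonal lie in boundedly many rows, those far from it carry only a
  tail of the convergent series of the squared moduli of the Fourier coefficients of \<open>g\<close>; hence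
  the squared Frobenius norm is \<open>o(n)\<close> (\<open>toeplitz_minus_block_toeplitz_frobenius\<close>).

  For the parts that are small in \<open>L\<^sup>1\<close>, namely \<open>T\<^sub>n(u)\<close>, \<open>LT\<^sub>n\<^sup>m(1, u)\<close> and \<open>T\<^sub>n(h n)\<close>, the
  real and imaginary parts are decomposed into positive and negative parts.  A nonnegative generating
  function gives a positive semidefinite matrix whose trace is at most \<open>n\<close> times the mean of the
  function (\<open>low_rank_plus_small_block_toeplitz\<close>).

  A small squared Frobenius norm, or a small trace of a positive semidefinite matrix, is turned
  into low rank plus small norm without singular values, by greedy deflation: as long as some
  vector is stretched by more than \<open>\<delta>\<close>, subtracting a suitable matrix of rank one lowers the
  nonnegative quantity by a fixed amount, which can happen only as often as the initial value allows
  (\<open>low_rank_plus_small_greedy\<close>).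
\<close>

section \<open>Matrices of low rank plus small norm\<close>

lemma cmod_diff_power2: "(cmod (z - w))\<^sup>2 = (cmod z)\<^sup>2 - 2 * Re (z * cnj w) + (cmod w)\<^sup>2"
  unfolding cmod_power2 by (simp add: algebra_simps power2_eq_square)

lemma (in vec_space) rank_smult_le:
  assumes A: "A \<in> carrier_mat n nc"
  shows "rank (a \<cdot>\<^sub>m A) \<le> rank A"
proof -
  have colsV: "set (cols A) \<subseteq> carrier_vec n"
    using A cols_dim[of A] by auto
  have sub: "set (cols (a \<cdot>\<^sub>m A)) \<subseteq> span (set (cols A))"
  proof
    fix v assume "v \<in> set (cols (a \<cdot>\<^sub>m A))"
    then obtain c where c: "c < dim_col A" "v = col (a \<cdot>\<^sub>m A) c"
      by (metis cols_length cols_nth in_set_conv_nth index_smult_mat(3))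
    have "v = a \<cdot>\<^sub>v col A c"
      using c by auto
    moreover have "col A c \<in> set (cols A)"
      using c(1) by (metis cols_length cols_nth nth_mem)
    then have "col A c \<in> span (set (cols A))"
      using in_own_span[OF colsV] by auto
    ultimately show "v \<in> span (set (cols A))"
      using submodule.smult_closed[OF span_is_submodule[OF colsV]]
      by (simp add: module_vec_simps)
  qed
  let ?W = "span (set (cols A))"
  have vs: "vectorspace class_ring (vs ?W)"
    using span_is_subspace[THEN subspace_is_vs, of "set (cols A)"] colsV by auto
  have sm: "submodule class_ring ?W V"
    using colsV by (simp add: span_is_submodule)
  have "subspace class_ring (span (set (cols (a \<cdot>\<^sub>m A)))) (vs ?W)"
    using vectorspace.span_is_subspace[OF vs, of "set (cols (a \<cdot>\<^sub>m A))", unfolded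
    span_li_not_depend(1)[OF sub sm]] sub by auto
  moreover have "vectorspace.fin_dim class_ring (vs ?W)"
       "vectorspace.fin_dim class_ring (vs ?W\<lparr>carrier := span (set (cols (a \<cdot>\<^sub>m A)))\<rparr>)"
    using fin_dim_span_cols[OF A] fin_dim_span_cols[of "a \<cdot>\<^sub>m A" nc] A by auto
  ultimately show ?thesis
    unfolding rank_def using "vectorspace.subspace_dim"[OF vs] by simp
qed

text \<open>
  The bound on \<open>N\<close> is stated for all vectors, not through the supremum in \<^const>\<open>spectral_norm\<close>,
  so that it adds up and scales without discussing whether that supremum exists.
\<close>

definition low_rank_plus_small :: "nat \<Rightarrow> real \<Rightarrow> real \<Rightarrow> complex mat \<Rightarrow> bool" where
  "low_rank_plus_small n k \<delta> A \<longleftrightarrow>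
     (\<exists>R \<in> carrier_mat n n. \<exists>N \<in> carrier_mat n n. A = R + N \<and> real (vec_space.rank n R) \<le> k \<and>
        (\<forall>v \<in> carrier_vec n. l2_norm_vec (N *\<^sub>v v) \<le> \<delta> * l2_norm_vec v))"

lemma l2_norm_vec_nonneg: "0 \<le> l2_norm_vec v"
  by (simp add: l2_norm_vec_def L2_set_nonneg)

lemma l2_norm_vec_add:
  assumes "v \<in> carrier_vec n" "w \<in> carrier_vec n"
  shows "l2_norm_vec (v + w) \<le> l2_norm_vec v + l2_norm_vec w"
proof -
  have "l2_norm_vec (v + w) \<le> L2_set (\<lambda>i. cmod (vec_index v i) + cmod (vec_index w i)) {..<n}"
    using assms unfolding l2_norm_vec_def by (auto intro!: L2_set_mono norm_triangle_ineq)
  also have "\<dots> \<le> l2_norm_vec v + l2_norm_vec w"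
    using assms unfolding l2_norm_vec_def by (auto intro: L2_set_triangle_ineq)
  finally show ?thesis .
qed

lemma l2_norm_vec_smult: "l2_norm_vec (a \<cdot>\<^sub>v v) = cmod a * l2_norm_vec v"
proof -
  have "l2_norm_vec (a \<cdot>\<^sub>v v) = L2_set (\<lambda>i. cmod a * cmod (vec_index v i)) {..<dim_vec v}"
    unfolding l2_norm_vec_def by (intro L2_set_cong) (auto simp: norm_mult)
  then show ?thesis
    by (simp add: l2_norm_vec_def L2_set_right_distrib)
qed

lemma low_rank_plus_small_add:
  assumes "low_rank_plus_small n k \<delta> A" "low_rank_plus_small n l \<epsilon> B"
  shows "low_rank_plus_small n (k + l) (\<delta> + \<epsilon>) (A + B)"
proof -
  obtain R N where RN: "R \<in> carrier_mat n n" "N \<in> carrier_mat n n" "A = R + N"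
      "real (vec_space.rank n R) \<le> k"
      "\<And>v. v \<in> carrier_vec n \<Longrightarrow> l2_norm_vec (N *\<^sub>v v) \<le> \<delta> * l2_norm_vec v"
    using assms(1) unfolding low_rank_plus_small_def by auto
  obtain S M where SM: "S \<in> carrier_mat n n" "M \<in> carrier_mat n n" "B = S + M"
      "real (vec_space.rank n S) \<le> l"
      "\<And>v. v \<in> carrier_vec n \<Longrightarrow> l2_norm_vec (M *\<^sub>v v) \<le> \<epsilon> * l2_norm_vec v"
    using assms(2) unfolding low_rank_plus_small_def by auto
  have "A + B = (R + S) + (N + M)"
    using RN SM by (intro eq_matI) auto
  moreover have "real (vec_space.rank n (R + S)) \<le> k + l"
    using vec_space.rank_subadditive[OF RN(1) SM(1)] RN(4) SM(4) by linarith
  moreover have "l2_norm_vec ((N + M) *\<^sub>v v) \<le> (\<delta> + \<epsilon>) * l2_norm_vec v"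
    if v: "v \<in> carrier_vec n" for v
  proof -
    have "l2_norm_vec ((N + M) *\<^sub>v v) \<le> l2_norm_vec (N *\<^sub>v v) + l2_norm_vec (M *\<^sub>v v)"
      using RN(2) SM(2) v by (subst add_mult_distrib_mat_vec) (auto intro!: l2_norm_vec_add[of _ n])
    then show ?thesis
      using RN(5)[OF v] SM(5)[OF v] by (simp add: algebra_simps)
  qed
  ultimately show ?thesis
    unfolding low_rank_plus_small_def using RN SM
    by (intro bexI[of _ "R + S"] bexI[of _ "N + M"]) auto
qed

lemma low_rank_plus_small_smult:
  assumes "low_rank_plus_small n k \<delta> A" "cmod a \<le> 1" "0 \<le> \<delta>"
  shows "low_rank_plus_small n k \<delta> (a \<cdot>\<^sub>m A)"
proof -
  obtain R N where RN: "R \<in> carrier_mat n n" "N \<in> carrier_mat n n" "A = R + N"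
      "real (vec_space.rank n R) \<le> k"
      "\<And>v. v \<in> carrier_vec n \<Longrightarrow> l2_norm_vec (N *\<^sub>v v) \<le> \<delta> * l2_norm_vec v"
    using assms(1) unfolding low_rank_plus_small_def by auto
  have "a \<cdot>\<^sub>m A = a \<cdot>\<^sub>m R + a \<cdot>\<^sub>m N"
    using RN by (intro eq_matI) (auto simp: algebra_simps)
  moreover have "real (vec_space.rank n (a \<cdot>\<^sub>m R)) \<le> k"
    using vec_space.rank_smult_le[OF RN(1), of a] RN(4) by linarith
  moreover have "l2_norm_vec ((a \<cdot>\<^sub>m N) *\<^sub>v v) \<le> \<delta> * l2_norm_vec v"
    if v: "v \<in> carrier_vec n" for v
  proof -
    have "(a \<cdot>\<^sub>m N) *\<^sub>v v = a \<cdot>\<^sub>v (N *\<^sub>v v)"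
      using RN(2) v by (intro eq_vecI) (auto simp: smult_scalar_prod_distrib[of _ n])
    then have "l2_norm_vec ((a \<cdot>\<^sub>m N) *\<^sub>v v) = cmod a * l2_norm_vec (N *\<^sub>v v)"
      by (simp add: l2_norm_vec_smult)
    also have "\<dots> \<le> 1 * (\<delta> * l2_norm_vec v)"
      using assms RN(5)[OF v] by (intro mult_mono) (auto simp: l2_norm_vec_nonneg)
    finally show ?thesis by simp
  qed
  ultimately show ?thesis
    unfolding low_rank_plus_small_def using RN
    by (intro bexI[of _ "a \<cdot>\<^sub>m R"] bexI[of _ "a \<cdot>\<^sub>m N"]) auto
qed

lemma low_rank_plus_small_mono:
  assumes "low_rank_plus_small n k \<delta> A" "k \<le> l" "\<delta> \<le> \<epsilon>"
  shows "low_rank_plus_small n l \<epsilon> A"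
proof -
  obtain R N where RN: "R \<in> carrier_mat n n" "N \<in> carrier_mat n n" "A = R + N"
      "real (vec_space.rank n R) \<le> k"
      "\<And>v. v \<in> carrier_vec n \<Longrightarrow> l2_norm_vec (N *\<^sub>v v) \<le> \<delta> * l2_norm_vec v"
    using assms(1) unfolding low_rank_plus_small_def by auto
  have "l2_norm_vec (N *\<^sub>v v) \<le> \<epsilon> * l2_norm_vec v" if "v \<in> carrier_vec n" for v
    using RN(5)[OF that] assms(3) by (meson l2_norm_vec_nonneg mult_right_mono order_trans)
  then show ?thesis
    unfolding low_rank_plus_small_def using RN assms(2)
    by (intro bexI[of _ R] bexI[of _ N]) auto
qed

lemma low_rank_plus_small_low_rank:
  assumes A: "A \<in> carrier_mat n n" and rank: "real (vec_space.rank n A) \<le> k" and "0 \<le> \<delta>"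
  shows "low_rank_plus_small n k \<delta> A"
proof -
  have "l2_norm_vec (0\<^sub>m n n *\<^sub>v v) \<le> \<delta> * l2_norm_vec v" if "v \<in> carrier_vec n" for v
  proof -
    have "l2_norm_vec (0\<^sub>m n n *\<^sub>v v) = 0"
      using that by (simp add: l2_norm_vec_def L2_set_def)
    then show ?thesis using \<open>0 \<le> \<delta>\<close> by (simp add: l2_norm_vec_nonneg)
  qed
  moreover have "A = A + 0\<^sub>m n n" using A by simp
  ultimately show ?thesis
    unfolding low_rank_plus_small_def using A rank
    by (intro bexI[of _ A] bexI[of _ "0\<^sub>m n n"]) auto
qed

lemma low_rank_plus_small_spectral_norm:
  assumes "low_rank_plus_small n k \<delta> A" "n > 0"
  shows "\<exists>R \<in> carrier_mat n n. \<exists>N \<in> carrier_mat n n. A = R + N \<and>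
           real (vec_space.rank n R) \<le> k \<and> spectral_norm N \<le> \<delta>"
proof -
  obtain R N where RN: "R \<in> carrier_mat n n" "N \<in> carrier_mat n n" "A = R + N"
      "real (vec_space.rank n R) \<le> k"
      "\<And>v. v \<in> carrier_vec n \<Longrightarrow> l2_norm_vec (N *\<^sub>v v) \<le> \<delta> * l2_norm_vec v"
    using assms(1) unfolding low_rank_plus_small_def by auto
  have "l2_norm_vec (unit_vec n 0) = L2_set (\<lambda>i. if i = 0 then 1 else 0) {..<n}"
    unfolding l2_norm_vec_def using assms(2) by (intro L2_set_cong) auto
  also have "\<dots> = 1"
    using assms(2) by (simp add: L2_set_def if_distrib[of "\<lambda>x. x ^ 2"] cong: if_cong)
  finally have "{v \<in> carrier_vec (dim_col N). l2_norm_vec v = 1} \<noteq> {}"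
    using RN(2) by (auto intro!: exI[of _ "unit_vec n 0"])
  then have "spectral_norm N \<le> \<delta>"
    unfolding spectral_norm_def using RN(2,5) by (intro cSUP_least) fastforce+
  then show ?thesis
    using RN by blast
qed

text \<open>
  \<open>\<phi>\<close> measures how far a matrix in the class \<open>P\<close> is from being small.  Each rank-one correction
  costs \<open>\<phi>\<close> at least \<open>\<eta>\<close> and \<open>\<phi>\<close> stays nonnegative, so at most \<open>\<phi> A / \<eta>\<close> corrections occur
  before no vector is stretched by more than \<open>\<delta>\<close>.
\<close>

lemma low_rank_plus_small_greedy:
  fixes \<phi> :: "complex mat \<Rightarrow> real"
  assumes "\<eta> > 0"
    and nonneg: "\<And>A. P A \<Longrightarrow> 0 \<le> \<phi> A"
    and carrier: "\<And>A. P A \<Longrightarrow> A \<in> carrier_mat n n"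
    and deflate: "\<And>A v. P A \<Longrightarrow> v \<in> carrier_vec n \<Longrightarrow> l2_norm_vec (A *\<^sub>v v) > \<delta> * l2_norm_vec v \<Longrightarrow>
       \<exists>x y. P (A - mat n n (\<lambda>(i, j). x i * y j)) \<and>
             \<phi> (A - mat n n (\<lambda>(i, j). x i * y j)) \<le> \<phi> A - \<eta>"
    and "P A"
  shows "low_rank_plus_small n (\<phi> A / \<eta>) \<delta> A"
  using \<open>P A\<close>
proof (induction "nat \<lfloor>\<phi> A / \<eta>\<rfloor>" arbitrary: A rule: less_induct)
  case (less A)
  have A: "A \<in> carrier_mat n n" using less.prems by (rule carrier)
  show ?case
  proof (cases "\<exists>v \<in> carrier_vec n. l2_norm_vec (A *\<^sub>v v) > \<delta> * l2_norm_vec v")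
    case False
    moreover have "A = 0\<^sub>m n n + A" using A by auto
    moreover have "real (vec_space.rank n (0\<^sub>m n n :: complex mat)) \<le> \<phi> A / \<eta>"
      using nonneg[OF less.prems] \<open>\<eta> > 0\<close> by (simp add: vec_space.rank_0I)
    ultimately show ?thesis
      unfolding low_rank_plus_small_def using A
      by (intro bexI[of _ "0\<^sub>m n n"] bexI[of _ A]) (auto simp: not_less)
  next
    case True
    then obtain x y where xy: "P (A - mat n n (\<lambda>(i, j). x i * y j))"
        "\<phi> (A - mat n n (\<lambda>(i, j). x i * y j)) \<le> \<phi> A - \<eta>"
      using deflate[OF less.prems] by blast
    define E where "E = mat n n (\<lambda>(i, j). x i * y j)"
    have E: "E \<in> carrier_mat n n" by (simp add: E_def)
    have rankE: "real (vec_space.rank n E) \<le> 1"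
      using vec_space.rank_le_1_product_entries[OF E, of x y] by (simp add: E_def)
    have le: "\<phi> (A - E) / \<eta> \<le> \<phi> A / \<eta> - 1"
      using xy(2) \<open>\<eta> > 0\<close> by (simp add: E_def field_simps)
    moreover have "0 \<le> \<phi> (A - E) / \<eta>"
      using nonneg[OF xy(1)] \<open>\<eta> > 0\<close> by (simp add: E_def)
    ultimately have "nat \<lfloor>\<phi> (A - E) / \<eta>\<rfloor> < nat \<lfloor>\<phi> A / \<eta>\<rfloor>"
      by linarith
    then have "low_rank_plus_small n (\<phi> (A - E) / \<eta>) \<delta> (A - E)"
      using less.hyps xy(1) by (simp add: E_def)
    then obtain R N where RN: "R \<in> carrier_mat n n" "N \<in> carrier_mat n n" "A - E = R + N"
      "real (vec_space.rank n R) \<le> \<phi> (A - E) / \<eta>"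
      "\<forall>v \<in> carrier_vec n. l2_norm_vec (N *\<^sub>v v) \<le> \<delta> * l2_norm_vec v"
      unfolding low_rank_plus_small_def by auto
    have "A = (A - E) + E" using A E by (intro eq_matI) auto
    also have "\<dots> = (R + E) + N" unfolding RN(3) using RN(1,2) E by (intro eq_matI) auto
    finally have "A = (R + E) + N" .
    moreover have "real (vec_space.rank n (R + E)) \<le> \<phi> A / \<eta>"
      using vec_space.rank_subadditive[OF RN(1) E] RN(4) rankE le by linarith
    ultimately show ?thesis
      unfolding low_rank_plus_small_def using RN E
      by (intro bexI[of _ "R + E"] bexI[of _ N]) auto
  qed
qed

section \<open>Deflation of Frobenius norm and of trace\<close>

lemma l2_norm_vec_power2:
  assumes "v \<in> carrier_vec n"
  shows "(l2_norm_vec v)\<^sup>2 = (\<Sum>i<n. (cmod (vec_index v i))\<^sup>2)"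
  using assms by (auto simp: l2_norm_vec_def L2_set_def sum_nonneg)

definition frobenius_sq :: "nat \<Rightarrow> complex mat \<Rightarrow> real" where
  "frobenius_sq n A = (\<Sum>i<n. \<Sum>j<n. (cmod (A $$ (i, j)))\<^sup>2)"

text \<open>
  Pythagoras in \<open>\<complex>\<^sup>n\<close>: subtracting from a row \<open>a\<close> its orthogonal projection onto the conjugate of
  \<open>v\<close>.
\<close>

lemma sum_cmod_diff_projection:
  fixes a v :: "nat \<Rightarrow> complex" and n :: nat
  defines "w \<equiv> \<Sum>j<n. a j * v j" and "s \<equiv> \<Sum>j<n. (cmod (v j))\<^sup>2"
  assumes "s \<noteq> 0"
  shows "(\<Sum>j<n. (cmod (a j - w / s * cnj (v j)))\<^sup>2) = (\<Sum>j<n. (cmod (a j))\<^sup>2) - (cmod w)\<^sup>2 / s"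
proof -
  have "(\<Sum>j<n. (cmod (a j - w / s * cnj (v j)))\<^sup>2)
      = (\<Sum>j<n. (cmod (a j))\<^sup>2) - 2 * Re (\<Sum>j<n. a j * cnj (w / s * cnj (v j)))
        + (\<Sum>j<n. (cmod (w / s * cnj (v j)))\<^sup>2)"
    by (simp add: cmod_diff_power2 sum.distrib sum_subtractf sum_distrib_left)
  also have "(\<Sum>j<n. a j * cnj (w / s * cnj (v j))) = (\<Sum>j<n. cnj w / s * (a j * v j))"
    by (intro sum.cong) auto
  also have "\<dots> = cnj w / s * w"
    unfolding w_def by (rule sum_distrib_left[symmetric])
  also have "cnj w / s * w = of_real ((cmod w)\<^sup>2) / of_real s"
    unfolding complex_norm_square by simp
  also have "\<dots> = of_real ((cmod w)\<^sup>2 / s)"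
    by simp
  also have "(\<Sum>j<n. (cmod (w / s * cnj (v j)))\<^sup>2) = (\<Sum>j<n. (cmod w / s)\<^sup>2 * (cmod (v j))\<^sup>2)"
    by (intro sum.cong) (auto simp: norm_mult norm_divide power_mult_distrib power_divide)
  also have "\<dots> = (cmod w / s)\<^sup>2 * s"
    by (simp add: s_def sum_distrib_left)
  also have "\<dots> = (cmod w)\<^sup>2 / s"
    using assms by (simp add: power2_eq_square)
  finally show ?thesis by simp
qed

lemma mult_mat_vec_index:
  assumes "A \<in> carrier_mat n n" "v \<in> carrier_vec n" "i < n"
  shows "vec_index (A *\<^sub>v v) i = (\<Sum>j<n. A $$ (i, j) * vec_index v j)"
  using assms by (auto simp: scalar_prod_def atLeast0LessThan intro!: sum.cong)

text \<open>
  If \<open>v\<close> is stretched too much, replacing \<open>A\<close> by \<open>A (1 - v v\<^sup>* / \<bar>v\<bar>\<^sup>2)\<close> removes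
  \<open>\<bar>A v\<bar>\<^sup>2 / \<bar>v\<bar>\<^sup>2 > \<delta>\<^sup>2\<close> from the squared Frobenius norm.
\<close>

lemma low_rank_plus_small_frobenius:
  assumes A: "A \<in> carrier_mat n n" and "\<delta> > 0"
  shows "low_rank_plus_small n (frobenius_sq n A / \<delta>\<^sup>2) \<delta> A"
proof (rule low_rank_plus_small_greedy[where P = "\<lambda>A. A \<in> carrier_mat n n"])
  show "\<delta>\<^sup>2 > 0" using \<open>\<delta> > 0\<close> by simp
  show "0 \<le> frobenius_sq n A" for A
    by (simp add: frobenius_sq_def sum_nonneg)
  fix A :: "complex mat" and v assume A: "A \<in> carrier_mat n n" and v: "v \<in> carrier_vec n"
    and large: "l2_norm_vec (A *\<^sub>v v) > \<delta> * l2_norm_vec v"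
  define w where "w i = (\<Sum>j<n. A $$ (i, j) * vec_index v j)" for i
  define s where "s = (\<Sum>j<n. (cmod (vec_index v j))\<^sup>2)"
  have Av: "A *\<^sub>v v \<in> carrier_vec n" using A v by auto
  have w2: "(l2_norm_vec (A *\<^sub>v v))\<^sup>2 = (\<Sum>i<n. (cmod (w i))\<^sup>2)"
    unfolding l2_norm_vec_power2[OF Av] w_def using A v
    by (intro sum.cong refl) (simp add: mult_mat_vec_index[of A n v] del: index_mult_mat_vec)
  have s2: "(l2_norm_vec v)\<^sup>2 = s"
    unfolding l2_norm_vec_power2[OF v] s_def ..
  have large2: "\<delta>\<^sup>2 * s < (\<Sum>i<n. (cmod (w i))\<^sup>2)"
    unfolding w2[symmetric] s2[symmetric] power_mult_distrib[symmetric]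
    using large \<open>\<delta> > 0\<close> by (intro power_strict_mono) (auto simp: l2_norm_vec_nonneg)
  have "s \<noteq> 0"
  proof
    assume "s = 0"
    then have "\<forall>j<n. vec_index v j = 0"
      unfolding s_def by (simp add: sum_nonneg_eq_0_iff)
    then have "(\<Sum>i<n. (cmod (w i))\<^sup>2) = 0"
      by (simp add: w_def)
    then show False using large2 \<open>s = 0\<close> by simp
  qed
  moreover have "s \<ge> 0" by (simp add: s_def sum_nonneg)
  ultimately have "s > 0" by simp
  let ?E = "mat n n (\<lambda>(i, j). w i / s * cnj (vec_index v j))"
  have "frobenius_sq n (A - ?E)
      = (\<Sum>i<n. \<Sum>j<n. (cmod (A $$ (i, j) - w i / s * cnj (vec_index v j)))\<^sup>2)"
    using A unfolding frobenius_sq_def by (intro sum.cong) auto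
  also have "\<dots> = (\<Sum>i<n. (\<Sum>j<n. (cmod (A $$ (i, j)))\<^sup>2) - (cmod (w i))\<^sup>2 / s)"
    unfolding w_def s_def using \<open>s \<noteq> 0\<close>
    by (intro sum.cong sum_cmod_diff_projection) (auto simp: s_def)
  also have "\<dots> = frobenius_sq n A - (\<Sum>i<n. (cmod (w i))\<^sup>2) / s"
    by (simp add: sum_subtractf sum_divide_distrib frobenius_sq_def)
  also have "\<dots> \<le> frobenius_sq n A - \<delta>\<^sup>2"
    using large2 \<open>s > 0\<close> by (simp add: field_simps)
  finally show "\<exists>x y. A - mat n n (\<lambda>(i, j). x i * y j) \<in> carrier_mat n n \<and>
      frobenius_sq n (A - mat n n (\<lambda>(i, j). x i * y j)) \<le> frobenius_sq n A - \<delta>\<^sup>2"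
    using A by (intro exI[of _ "\<lambda>i. w i / s"] exI[of _ "\<lambda>j. cnj (vec_index v j)"]) auto
qed (use A in auto)

text \<open>
  The sesquilinear form \<open>z\<^sup>* A u\<close>, with vectors as functions on the indices, which keeps dimension
  conditions out of the algebra.
\<close>

definition sesq :: "nat \<Rightarrow> complex mat \<Rightarrow> (nat \<Rightarrow> complex) \<Rightarrow> (nat \<Rightarrow> complex) \<Rightarrow> complex" where
  "sesq n A z u = (\<Sum>i<n. \<Sum>j<n. cnj (z i) * A $$ (i, j) * u j)"

definition pos_semidef :: "nat \<Rightarrow> complex mat \<Rightarrow> bool" where
  "pos_semidef n A \<longleftrightarrow> A \<in> carrier_mat n n \<and> (\<forall>i<n. \<forall>j<n. A $$ (j, i) = cnj (A $$ (i, j))) \<and>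
     (\<forall>z. 0 \<le> Re (sesq n A z z))"

lemma sesq_apply: "sesq n A z u = (\<Sum>i<n. cnj (z i) * (\<Sum>j<n. A $$ (i, j) * u j))"
  by (simp add: sesq_def sum_distrib_left mult.assoc)

lemma sesq_cnj:
  assumes "pos_semidef n A"
  shows "sesq n A u z = cnj (sesq n A z u)"
proof -
  have herm: "cnj (A $$ (i, j)) = A $$ (j, i)" if "i < n" "j < n" for i j
    using assms that unfolding pos_semidef_def by metis
  have "cnj (sesq n A z u) = (\<Sum>i<n. \<Sum>j<n. z i * cnj (A $$ (i, j)) * cnj (u j))"
    by (simp add: sesq_def)
  also have "\<dots> = (\<Sum>i<n. \<Sum>j<n. z i * A $$ (j, i) * cnj (u j))"
    by (intro sum.cong refl) (simp only: lessThan_iff herm)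
  also have "\<dots> = (\<Sum>j<n. \<Sum>i<n. z i * A $$ (j, i) * cnj (u j))"
    by (rule sum.swap)
  also have "\<dots> = sesq n A u z"
    unfolding sesq_def by (intro sum.cong refl) (simp only: mult.commute mult.left_commute)
  finally show ?thesis ..
qed

lemma Re_sesq_diff:
  assumes "pos_semidef n A"
  shows "Re (sesq n A (\<lambda>i. z i - t * u i) (\<lambda>i. z i - t * u i))
       = Re (sesq n A z z) - 2 * Re (t * sesq n A z u) + (cmod t)\<^sup>2 * Re (sesq n A u u)"
proof -
  have "sesq n A (\<lambda>i. z i - t * u i) (\<lambda>i. z i - t * u i)
      = sesq n A z z - t * sesq n A z u - cnj t * sesq n A u z + cnj t * t * sesq n A u u"
    unfolding sesq_def sum_distrib_left sum_subtractf[symmetric] sum.distrib[symmetric]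
    by (intro sum.cong) (auto simp: algebra_simps)
  also have "cnj t * sesq n A u z = cnj (t * sesq n A z u)"
    by (simp add: sesq_cnj[OF assms, of u z])
  also have "cnj t * t = of_real ((cmod t)\<^sup>2)"
    unfolding complex_norm_square by (rule mult.commute)
  finally show ?thesis by simp
qed

text \<open>
  For a positive semidefinite matrix a bound on the quadratic form bounds the operator norm: with
  \<open>w = A v\<close>, expand the nonnegative form at \<open>w - s v\<close> and choose the best real \<open>s\<close>.
\<close>

lemma pos_semidef_norm_le:
  assumes A: "pos_semidef n A" and "\<delta> > 0"
    and bound: "\<And>z. Re (sesq n A z z) \<le> \<delta> * (\<Sum>i<n. (cmod (z i))\<^sup>2)"
    and v: "v \<in> carrier_vec n"
  shows "l2_norm_vec (A *\<^sub>v v) \<le> \<delta> * l2_norm_vec v"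
proof -
  have Ac: "A \<in> carrier_mat n n" using A by (simp add: pos_semidef_def)
  define w where "w i = (\<Sum>j<n. A $$ (i, j) * vec_index v j)" for i
  define W where "W = (\<Sum>i<n. (cmod (w i))\<^sup>2)"
  define V where "V = (\<Sum>j<n. (cmod (vec_index v j))\<^sup>2)"
  have Av: "A *\<^sub>v v \<in> carrier_vec n" using Ac v by auto
  have W: "(l2_norm_vec (A *\<^sub>v v))\<^sup>2 = W"
    unfolding l2_norm_vec_power2[OF Av] w_def W_def using Ac v
    by (intro sum.cong refl) (simp add: mult_mat_vec_index[of A n v] del: index_mult_mat_vec)
  have V: "(l2_norm_vec v)\<^sup>2 = V"
    unfolding l2_norm_vec_power2[OF v] V_def ..
  have V0: "V \<ge> 0" by (simp add: V_def sum_nonneg)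
  have W0: "W \<ge> 0" by (simp add: W_def sum_nonneg)
  have "W \<le> \<delta>\<^sup>2 * V"
  proof (cases "V = 0")
    case True
    then have "\<forall>j<n. vec_index v j = 0"
      unfolding V_def by (simp add: sum_nonneg_eq_0_iff)
    then show ?thesis
      using True by (simp add: W_def w_def)
  next
    case False
    then have Vp: "V > 0" using V0 by simp
    \<comment> \<open>The minimiser in \<open>s\<close> of the upper bound \<open>\<delta> * W - 2 * s * W + s\<^sup>2 * (\<delta> * V)\<close>.\<close>
    define s where "s = W / (\<delta> * V)"
    have s0: "s \<ge> 0" using W0 V0 \<open>\<delta> > 0\<close> by (simp add: s_def)
    have zw: "sesq n A w (vec_index v) = of_real W"
      unfolding sesq_apply w_def[symmetric] W_def of_real_sum
      by (intro sum.cong refl) (unfold complex_norm_square, rule mult.commute)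
    have "0 \<le> Re (sesq n A (\<lambda>i. w i - of_real s * vec_index v i) (\<lambda>i. w i - of_real s * vec_index v i))"
      using A unfolding pos_semidef_def by blast
    also have "\<dots> = Re (sesq n A w w) - 2 * s * W + s\<^sup>2 * Re (sesq n A (vec_index v) (vec_index v))"
      unfolding Re_sesq_diff[OF A] zw by simp
    also have "\<dots> \<le> \<delta> * W - 2 * s * W + s\<^sup>2 * (\<delta> * V)"
      using bound[of w] bound[of "vec_index v"] s0 unfolding W_def V_def
      by (intro add_mono diff_mono mult_left_mono) auto
    also have "\<dots> = \<delta> * W - W * W / (\<delta> * V)"
      using Vp \<open>\<delta> > 0\<close> unfolding s_def by (simp add: field_simps power2_eq_square)
    finally have "W * W / (\<delta> * V) \<le> \<delta> * W" by simp
    then have "W * W \<le> W * (\<delta>\<^sup>2 * V)"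
      using Vp \<open>\<delta> > 0\<close> by (simp add: field_simps power2_eq_square)
    then show ?thesis
      using V0 W0 by (cases "W = 0") auto
  qed
  then have "(l2_norm_vec (A *\<^sub>v v))\<^sup>2 \<le> (\<delta> * l2_norm_vec v)\<^sup>2"
    unfolding power_mult_distrib W V .
  then show ?thesis
    by (rule power2_le_imp_le) (use \<open>\<delta> > 0\<close> in \<open>simp add: l2_norm_vec_nonneg\<close>)
qed

definition re_trace :: "nat \<Rightarrow> complex mat \<Rightarrow> real" where
  "re_trace n A = (\<Sum>i<n. Re (A $$ (i, i)))"

text \<open>
  If the quadratic form exceeds \<open>\<delta> \<bar>u\<bar>\<^sup>2\<close> at some \<open>u\<close>, put \<open>y = A u\<close>, \<open>q = u\<^sup>* y\<close> and pass to
  \<open>A - y y\<^sup>* / q\<close>.  This matrix is again positive semidefinite: at \<open>z\<close> its form has the value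
  that the form of \<open>A\<close> has at a translate of \<open>z\<close> by a multiple of \<open>u\<close>.  The trace drops by
  \<open>\<bar>y\<bar>\<^sup>2 / q\<close>, and \<open>q \<le> \<bar>u\<bar> \<bar>y\<bar>\<close> by Cauchy-Schwarz, so that
  \<open>\<bar>y\<bar>\<^sup>2 / q \<ge> q / \<bar>u\<bar>\<^sup>2 > \<delta>\<close>.
\<close>

lemma low_rank_plus_small_pos_semidef:
  assumes A: "pos_semidef n A" and "\<delta> > 0"
  shows "low_rank_plus_small n (re_trace n A / \<delta>) \<delta> A"
proof (rule low_rank_plus_small_greedy[where P = "pos_semidef n"])
  show "\<delta> > 0" "pos_semidef n A" by fact+
  show "A \<in> carrier_mat n n" if "pos_semidef n A" for A
    using that unfolding pos_semidef_def by blast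
  show "0 \<le> re_trace n A" if A: "pos_semidef n A" for A
    unfolding re_trace_def
  proof (rule sum_nonneg)
    fix k assume k: "k \<in> {..<n}"
    have "sesq n A (\<lambda>i. if i = k then 1 else 0) (\<lambda>i. if i = k then 1 else 0) = A $$ (k, k)"
      using k by (simp add: sesq_apply if_distrib[of cnj] mult_delta_left mult_delta_right cong: if_cong)
    then show "0 \<le> Re (A $$ (k, k))"
      using A unfolding pos_semidef_def by metis
  qed
  fix A :: "complex mat" and v assume A: "pos_semidef n A" and v: "v \<in> carrier_vec n"
    and large: "l2_norm_vec (A *\<^sub>v v) > \<delta> * l2_norm_vec v"
  have Ac: "A \<in> carrier_mat n n" using A by (simp add: pos_semidef_def)
  obtain u where u: "Re (sesq n A u u) > \<delta> * (\<Sum>i<n. (cmod (u i))\<^sup>2)"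
    using pos_semidef_norm_le[OF A \<open>\<delta> > 0\<close> _ v] large by (meson not_le)
  define U where "U = (\<Sum>i<n. (cmod (u i))\<^sup>2)"
  define q where "q = Re (sesq n A u u)"
  define y where "y i = (\<Sum>j<n. A $$ (i, j) * u j)" for i
  define Y where "Y = (\<Sum>i<n. (cmod (y i))\<^sup>2)"
  have U0: "U \<ge> 0" by (simp add: U_def sum_nonneg)
  have qU: "q > \<delta> * U" using u by (simp add: q_def U_def)
  have q0: "q > 0" using qU U0 \<open>\<delta> > 0\<close> by (smt (verit) mult_nonneg_nonneg)
  have qy: "q = Re (\<Sum>i<n. cnj (u i) * y i)"
    by (simp add: q_def sesq_apply y_def)
  have "q \<le> (\<Sum>i<n. \<bar>cmod (u i)\<bar> * \<bar>cmod (y i)\<bar>)"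
    unfolding qy
    by (intro order_trans[OF complex_Re_le_cmod] order_trans[OF norm_sum]) (auto simp: norm_mult)
  also have "\<dots> \<le> L2_set (\<lambda>i. cmod (u i)) {..<n} * L2_set (\<lambda>i. cmod (y i)) {..<n}"
    by (rule L2_set_mult_ineq)
  also have "\<dots> = sqrt (U * Y)"
    by (simp add: L2_set_def U_def Y_def real_sqrt_mult)
  finally have "q\<^sup>2 \<le> (sqrt (U * Y))\<^sup>2"
    using q0 by (intro power_mono) auto
  moreover have "U * Y \<ge> 0"
    using U0 by (simp add: Y_def sum_nonneg)
  ultimately have "q\<^sup>2 \<le> U * Y"
    by simp
  have "\<delta> * q \<le> Y"
  proof (cases "U = 0")
    case True
    then show ?thesis using \<open>q\<^sup>2 \<le> U * Y\<close> q0 by simp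
  next
    case False
    then have "U > 0" using U0 by simp
    have "\<delta> * U * q \<le> q * q" using qU q0 by (intro mult_right_mono) auto
    also have "\<dots> \<le> U * Y" using \<open>q\<^sup>2 \<le> U * Y\<close> by (simp add: power2_eq_square)
    finally have "U * (\<delta> * q) \<le> U * Y" by (simp add: algebra_simps)
    then show ?thesis using \<open>U > 0\<close> by simp
  qed
  let ?E = "mat n n (\<lambda>(i, j). y i / q * cnj (y j))"
  have "pos_semidef n (A - ?E)"
    unfolding pos_semidef_def
  proof (intro conjI allI impI)
    show "A - ?E \<in> carrier_mat n n" by (rule minus_carrier_mat) simp
    show "(A - ?E) $$ (j, i) = cnj ((A - ?E) $$ (i, j))" if "i < n" "j < n" for i j
    proof -
      have "A $$ (j, i) = cnj (A $$ (i, j))"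
        using A that unfolding pos_semidef_def by blast
      then show ?thesis using Ac that by simp
    qed
    fix z
    define B where "B = (\<Sum>i<n. cnj (z i) * y i)"
    have B: "sesq n A z u = B" by (simp add: B_def sesq_apply y_def)
    have "sesq n (A - ?E) z z
        = (\<Sum>i<n. \<Sum>j<n. cnj (z i) * A $$ (i, j) * z j - (cnj (z i) * y i) * cnj (cnj (z j) * y j) / q)"
      unfolding sesq_def using Ac by (intro sum.cong) (auto simp: algebra_simps)
    also have "\<dots> = sesq n A z z - B * cnj B / q"
      by (simp add: sum_subtractf sesq_def B_def sum_product sum_divide_distrib)
    also have "B * cnj B = of_real ((cmod B)\<^sup>2)"
      by (simp only: complex_norm_square)
    finally have 1: "Re (sesq n (A - ?E) z z) = Re (sesq n A z z) - (cmod B)\<^sup>2 / q"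
      by simp
    \<comment> \<open>The multiple of \<open>u\<close> that minimises the form of \<open>A\<close> at \<open>z - t u\<close>.\<close>
    define t where "t = cnj B / q"
    have "t * B = of_real ((cmod B)\<^sup>2 / q)"
      unfolding t_def of_real_divide complex_norm_square by simp
    moreover have "(cmod t)\<^sup>2 * q = (cmod B)\<^sup>2 / q"
      using q0 by (simp add: t_def norm_divide power_divide power2_eq_square)
    ultimately have "Re (sesq n A (\<lambda>i. z i - t * u i) (\<lambda>i. z i - t * u i))
        = Re (sesq n A z z) - (cmod B)\<^sup>2 / q"
      unfolding Re_sesq_diff[OF A] B q_def[symmetric] by simp
    then show "0 \<le> Re (sesq n (A - ?E) z z)"
      using A unfolding 1 pos_semidef_def by metis
  qed
  moreover have "re_trace n (A - ?E) = re_trace n A - Y / q"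
  proof -
    have diag: "y i / q * cnj (y i) = of_real ((cmod (y i))\<^sup>2 / q)" for i
      unfolding of_real_divide complex_norm_square by simp
    have "re_trace n (A - ?E) = (\<Sum>i<n. Re (A $$ (i, i)) - (cmod (y i))\<^sup>2 / q)"
      unfolding re_trace_def
    proof (intro sum.cong refl)
      fix i assume "i \<in> {..<n}"
      then have "(A - ?E) $$ (i, i) = A $$ (i, i) - y i / q * cnj (y i)"
        using Ac by simp
      then show "Re ((A - ?E) $$ (i, i)) = Re (A $$ (i, i)) - (cmod (y i))\<^sup>2 / q"
        unfolding diag by simp
    qed
    then show ?thesis
      by (simp add: sum_subtractf re_trace_def Y_def sum_divide_distrib)
  qed
  moreover have "Y / q \<ge> \<delta>" using \<open>\<delta> * q \<le> Y\<close> q0 by (simp add: field_simps)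
  ultimately show "\<exists>x y. pos_semidef n (A - mat n n (\<lambda>(i, j). x i * y j)) \<and>
      re_trace n (A - mat n n (\<lambda>(i, j). x i * y j)) \<le> re_trace n A - \<delta>"
    by (intro exI[of _ "\<lambda>i. y i / q"] exI[of _ "\<lambda>j. cnj (y j)"]) auto
qed

section \<open>Fourier coefficients and Bessel's inequality\<close>

text \<open>
  Restricting the measure to \<open>[-\<pi>, \<pi>]\<close> turns set integrals into plain Bochner integrals over a
  finite measure space.
\<close>

abbreviation torus :: "real measure" where
  "torus \<equiv> lebesgue_on {-pi..pi}"

definition character :: "int \<Rightarrow> real \<Rightarrow> complex" where
  "character k \<theta> = exp (- (of_int k * \<i> * of_real \<theta>))"

lemma norm_character [simp]: "cmod (character k \<theta>) = 1"
  by (simp add: character_def)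

lemma character_0 [simp]: "character 0 \<theta> = 1"
  by (simp add: character_def)

lemma character_diff: "character (k - l) \<theta> = character k \<theta> * cnj (character l \<theta>)"
  by (simp add: character_def exp_cnj exp_add[symmetric] algebra_simps)

lemma cnj_character: "cnj (character k \<theta>) = character (- k) \<theta>"
  using character_diff[of 0 k \<theta>] by simp

lemma measurable_character [measurable]: "character k \<in> borel_measurable torus"
  unfolding character_def
  by (intro continuous_imp_measurable_on_sets_lebesgue continuous_intros) auto

lemma finite_measure_torus: "finite_measure torus"
  by (intro finite_measure_lebesgue_on) simp

lemma measure_torus: "measure torus (space torus) = 2 * pi"
  by (simp add: measure_restrict_space space_restrict_space)

lemma absolutely_integrable_on_torus_iff:
  fixes f :: "real \<Rightarrow> complex"
  shows "f absolutely_integrable_on {-pi..pi} \<longleftrightarrow> integrable torus f"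
  by (simp add: set_integrable_eq)

lemma integrable_torus_bounded:
  fixes f :: "real \<Rightarrow> 'b :: {banach, second_countable_topology}"
  assumes "f \<in> borel_measurable torus" "\<And>\<theta>. norm (f \<theta>) \<le> M"
  shows "integrable torus f"
  using assms finite_measure_torus by (intro finite_measure.integrable_const_bound[of _ _ M]) auto

lemma integrable_mult_character:
  assumes "integrable torus f"
  shows "integrable torus (\<lambda>\<theta>. f \<theta> * character k \<theta>)"
proof -
  have [measurable]: "f \<in> borel_measurable torus" using assms by simp
  show ?thesis
    using assms by (rule Bochner_Integration.integrable_bound) (measurable, simp add: norm_mult)
qed

lemma fourier_coeff_eq:
  "fourier_coeff f k = integral\<^sup>L torus (\<lambda>\<theta>. f \<theta> * character k \<theta>) / of_real (2 * pi)"
  unfolding fourier_coeff_def character_def set_lebesgue_integral_def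
  by (subst integral_restrict_space) auto

lemma fourier_coeff_add:
  assumes "integrable torus f" "integrable torus g"
  shows "fourier_coeff (\<lambda>\<theta>. f \<theta> + g \<theta>) k = fourier_coeff f k + fourier_coeff g k"
  using assms by (simp add: fourier_coeff_eq distrib_right integrable_mult_character add_divide_distrib)

lemma fourier_coeff_mult: "fourier_coeff (\<lambda>\<theta>. a * f \<theta>) k = a * fourier_coeff f k"
  by (simp add: fourier_coeff_eq mult.assoc)

lemma fourier_coeff_sum:
  assumes "\<And>j. j \<in> J \<Longrightarrow> integrable torus (f j)"
  shows "fourier_coeff (\<lambda>\<theta>. \<Sum>j\<in>J. f j \<theta>) k = (\<Sum>j\<in>J. fourier_coeff (f j) k)"
  using assms
  by (simp add: fourier_coeff_eq sum_distrib_right integrable_mult_character sum_divide_distrib)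

lemma integral_character: "integral\<^sup>L torus (character k) = (if k = 0 then of_real (2 * pi) else 0)"
proof (cases "k = 0")
  case True
  then have "character k = (\<lambda>_. 1)" by auto
  then show ?thesis
    using True finite_measure_torus measure_torus by (simp add: scaleR_conv_of_real)
next
  case False
  define F where "F \<theta> = character k \<theta> / (- (of_int k * \<i>))" for \<theta>
  have exp_pi: "exp (\<i> * (of_int k * of_real pi)) = exp (- (\<i> * (of_int k * of_real pi)))"
  proof -
    have "exp (\<i> * (of_int k * of_real pi)) = exp (- (\<i> * (of_int k * of_real pi)) + of_int (2 * k) * (of_real pi * \<i>))"
      by (simp add: algebra_simps)
    also have "\<dots> = exp (- (\<i> * (of_int k * of_real pi)))"
      unfolding exp_eq by auto
    finally show ?thesis .
  qed
  have "(character k has_integral (F pi - F (-pi))) {-pi..pi}"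
  proof (rule fundamental_theorem_of_calculus)
    fix x assume "x \<in> {-pi..pi}"
    have "((\<lambda>z. exp (- (of_int k * \<i> * z)) / (- (of_int k * \<i>))) has_field_derivative
         exp (- (of_int k * \<i> * of_real x))) (at (of_real x))"
      using False by (auto intro!: derivative_eq_intros)
    from has_vector_derivative_real_field[OF this]
    show "(F has_vector_derivative character k x) (at x within {-pi..pi})"
      by (simp add: F_def[abs_def] character_def)
  qed simp
  moreover have "F pi = F (-pi)"
    using exp_pi by (simp add: F_def character_def mult_ac)
  ultimately have "(character k has_integral 0) {-pi..pi}" by simp
  moreover have "integrable torus (character k)"
    by (rule integrable_torus_bounded[of _ 1]) auto
  ultimately show ?thesis
    using False lebesgue_integral_eq_integral[of "{-pi..pi}" "character k"]
    by (simp add: integral_unique)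
qed

text \<open>
  The squared \<open>L\<^sup>2\<close> distance from \<open>g\<close> to its partial Fourier sum \<open>p\<close> is nonnegative, and by
  orthogonality of the characters both \<open>\<integral> g cnj p\<close> and \<open>\<integral> \<bar>p\<bar>\<^sup>2\<close> equal \<open>2 \<pi>\<close> times the
  sum in question.
\<close>

lemma Bessel_inequality:
  assumes [measurable]: "g \<in> borel_measurable torus" and bound: "\<And>\<theta>. cmod (g \<theta>) \<le> M"
    and "finite K"
  shows "(\<Sum>k\<in>K. (cmod (fourier_coeff g k))\<^sup>2) \<le> M\<^sup>2"
proof -
  define S where "S = (\<Sum>k\<in>K. (cmod (fourier_coeff g k))\<^sup>2)"
  define p where "p \<theta> = (\<Sum>k\<in>K. fourier_coeff g k * cnj (character k \<theta>))" for \<theta>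
  have [measurable]: "p \<in> borel_measurable torus"
    unfolding p_def[abs_def] cnj_character by measurable
  have p_bound: "cmod (p \<theta>) \<le> (\<Sum>k\<in>K. cmod (fourier_coeff g k))" for \<theta>
    unfolding p_def by (intro order_trans[OF norm_sum]) (auto simp: norm_mult)
  have int_g: "integrable torus g"
    by (rule integrable_torus_bounded[OF _ bound]) auto
  have int_p: "integrable torus p"
    by (rule integrable_torus_bounded[OF _ p_bound]) auto
  have M0: "0 \<le> M" using bound[of 0] norm_ge_zero order_trans by blast
  have int_gg: "integrable torus (\<lambda>\<theta>. (cmod (g \<theta>))\<^sup>2)"
    using bound by (intro integrable_torus_bounded[of _ "M\<^sup>2"]) (auto intro: power_mono)
  have [measurable]: "(\<lambda>\<theta>. cnj (p \<theta>)) \<in> borel_measurable torus"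
    by (rule measurable_compose[OF _ borel_measurable_continuous_onI]) (auto intro: continuous_intros)
  have int_gp: "integrable torus (\<lambda>\<theta>. g \<theta> * cnj (p \<theta>))"
    using bound p_bound M0
    by (intro integrable_torus_bounded[of _ "M * (\<Sum>k\<in>K. cmod (fourier_coeff g k))"])
       (auto simp: norm_mult intro!: mult_mono borel_measurable_times)
  have int_pp: "integrable torus (\<lambda>\<theta>. (cmod (p \<theta>))\<^sup>2)"
    using p_bound
    by (intro integrable_torus_bounded[of _ "(\<Sum>k\<in>K. cmod (fourier_coeff g k))\<^sup>2"]) (auto intro: power_mono)
  have pair: "integral\<^sup>L torus (\<lambda>\<theta>. u \<theta> * cnj (p \<theta>))
      = of_real (2 * pi) * (\<Sum>k\<in>K. fourier_coeff u k * cnj (fourier_coeff g k))"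
    if "integrable torus u" for u
  proof -
    have "integral\<^sup>L torus (\<lambda>\<theta>. u \<theta> * cnj (p \<theta>))
        = integral\<^sup>L torus (\<lambda>\<theta>. \<Sum>k\<in>K. cnj (fourier_coeff g k) * (u \<theta> * character k \<theta>))"
      by (simp add: p_def sum_distrib_left algebra_simps)
    also have "\<dots> = (\<Sum>k\<in>K. cnj (fourier_coeff g k) * integral\<^sup>L torus (\<lambda>\<theta>. u \<theta> * character k \<theta>))"
      using that by (subst Bochner_Integration.integral_sum) (auto intro: integrable_mult_character)
    also have "\<dots> = of_real (2 * pi) * (\<Sum>k\<in>K. fourier_coeff u k * cnj (fourier_coeff g k))"
      by (simp add: fourier_coeff_eq sum_distrib_left algebra_simps)
    finally show ?thesis .
  qed
  have "fourier_coeff p k = fourier_coeff g k" if "k \<in> K" for k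
  proof -
    have "fourier_coeff p k = (\<Sum>l\<in>K. fourier_coeff g l * fourier_coeff (\<lambda>\<theta>. cnj (character l \<theta>)) k)"
      unfolding p_def[abs_def]
      by (subst fourier_coeff_sum)
         (auto simp: fourier_coeff_mult cnj_character intro!: integrable_torus_bounded[of _ 1] integrable_mult_right)
    also have "\<dots> = (\<Sum>l\<in>K. if l = k then fourier_coeff g l else 0)"
    proof (intro sum.cong refl)
      fix l
      have "(\<lambda>\<theta>. cnj (character l \<theta>) * character k \<theta>) = character (k - l)"
        by (auto simp: character_diff)
      then have "fourier_coeff (\<lambda>\<theta>. cnj (character l \<theta>)) k = (if l = k then 1 else 0)"
        by (simp add: fourier_coeff_eq integral_character)
      then show "fourier_coeff g l * fourier_coeff (\<lambda>\<theta>. cnj (character l \<theta>)) k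
          = (if l = k then fourier_coeff g l else 0)" by simp
    qed
    also have "\<dots> = fourier_coeff g k"
      using that \<open>finite K\<close> by simp
    finally show ?thesis .
  qed
  then have pp: "integral\<^sup>L torus (\<lambda>\<theta>. p \<theta> * cnj (p \<theta>)) = of_real (2 * pi * S)"
    unfolding pair[OF int_p] S_def by (simp add: complex_norm_square del: of_real_power)
  have gp: "integral\<^sup>L torus (\<lambda>\<theta>. g \<theta> * cnj (p \<theta>)) = of_real (2 * pi * S)"
    unfolding pair[OF int_g] S_def by (simp add: complex_norm_square del: of_real_power)
  have "integral\<^sup>L torus (\<lambda>\<theta>. of_real ((cmod (p \<theta>))\<^sup>2)) = complex_of_real (2 * pi * S)"
    using pp by (simp add: complex_norm_square del: of_real_power)
  then have pp': "integral\<^sup>L torus (\<lambda>\<theta>. (cmod (p \<theta>))\<^sup>2) = 2 * pi * S"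
    unfolding integral_complex_of_real of_real_eq_iff .
  have gp': "integral\<^sup>L torus (\<lambda>\<theta>. Re (g \<theta> * cnj (p \<theta>))) = 2 * pi * S"
    using integral_Re[OF int_gp] gp by simp
  have "0 \<le> integral\<^sup>L torus (\<lambda>\<theta>. (cmod (g \<theta> - p \<theta>))\<^sup>2)"
    by simp
  also have "\<dots> = integral\<^sup>L torus (\<lambda>\<theta>. (cmod (g \<theta>))\<^sup>2 - 2 * Re (g \<theta> * cnj (p \<theta>)) + (cmod (p \<theta>))\<^sup>2)"
    by (intro Bochner_Integration.integral_cong) (simp_all only: cmod_diff_power2)
  also have "\<dots> = integral\<^sup>L torus (\<lambda>\<theta>. (cmod (g \<theta>))\<^sup>2) - 2 * (2 * pi * S) + 2 * pi * S"
    using int_gg integrable_Re[OF int_gp] int_pp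
    by (simp only: Bochner_Integration.integral_add Bochner_Integration.integral_diff
        integrable_mult_right Bochner_Integration.integrable_diff integral_mult_right_zero pp' gp')
  finally have "2 * pi * S \<le> integral\<^sup>L torus (\<lambda>\<theta>. (cmod (g \<theta>))\<^sup>2)"
    by linarith
  also have "\<dots> \<le> integral\<^sup>L torus (\<lambda>\<theta>. M\<^sup>2)"
    using int_gg bound finite_measure_torus
    by (intro integral_mono finite_measure.integrable_const) (auto intro: power_mono)
  also have "\<dots> = 2 * pi * M\<^sup>2"
    using finite_measure_torus measure_torus by simp
  finally show ?thesis by (simp add: S_def)
qed

lemma fourier_coeff_square_tail:
  assumes "g \<in> borel_measurable torus" "\<And>\<theta>. cmod (g \<theta>) \<le> M" and "e > 0"
  obtains K :: nat where "\<forall>L. finite L \<and> (\<forall>k\<in>L. \<bar>k\<bar> > int K) \<longrightarrow>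
    (\<Sum>k\<in>L. (cmod (fourier_coeff g k))\<^sup>2) \<le> e"
proof -
  define a where "a k = (cmod (fourier_coeff g k))\<^sup>2" for k
  define \<S> where "\<S> = sum a ` {K. finite K}"
  have bdd: "bdd_above \<S>"
    using Bessel_inequality[OF assms(1,2)] by (auto simp: \<S>_def a_def bdd_above_def)
  have "\<S> \<noteq> {}" by (auto simp: \<S>_def)
  then obtain K where K: "finite K" "Sup \<S> - e < sum a K"
    using less_cSup_iff[OF _ bdd, of "Sup \<S> - e"] \<open>e > 0\<close> by (auto simp: \<S>_def)
  define N where "N = nat (Max (insert 0 (abs ` K)))"
  have N: "\<bar>k\<bar> \<le> int N" if "k \<in> K" for k
    using that K(1) Max_ge[of "insert 0 (abs ` K)" "\<bar>k\<bar>"] unfolding N_def by (simp del: Max_insert)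
  show thesis
  proof (rule that[of N], intro allI impI, elim conjE)
    fix L assume L: "finite L" "\<forall>k\<in>L. \<bar>k\<bar> > int N"
    have "K \<inter> L = {}" using N L(2) by force
    then have "sum a K + sum a L = sum a (K \<union> L)"
      using K(1) L(1) by (simp add: sum.union_disjoint)
    also have "\<dots> \<le> Sup \<S>"
      using K(1) L(1) by (intro cSup_upper bdd) (auto simp: \<S>_def)
    finally show "(\<Sum>k\<in>L. (cmod (fourier_coeff g k))\<^sup>2) \<le> e"
      using K(2) by (simp add: a_def)
  qed
qed

definition L1_mean :: "(real \<Rightarrow> complex) \<Rightarrow> real" where
  "L1_mean f = integral\<^sup>L torus (\<lambda>\<theta>. cmod (f \<theta>)) / (2 * pi)"

text \<open>
  Setting \<open>f\<close> to zero where its modulus exceeds \<open>N\<close> changes it by an amount that tends to zero in \<open>L\<^sup>1\<close>,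
  by dominated convergence.
\<close>

lemma L1_truncation:
  assumes f: "integrable torus f" and "\<eta> > 0"
  obtains g M where "g \<in> borel_measurable torus" "\<And>\<theta>. cmod (g \<theta>) \<le> M"
    "L1_mean (\<lambda>\<theta>. f \<theta> - g \<theta>) \<le> \<eta>"
proof -
  define g where "g N \<theta> = (if cmod (f \<theta>) \<le> real N then f \<theta> else 0)" for N \<theta>
  have [measurable]: "f \<in> borel_measurable torus" using f by auto
  have g_meas[measurable]: "g N \<in> borel_measurable torus" for N
    unfolding g_def by measurable
  have "(\<lambda>N. integral\<^sup>L torus (\<lambda>\<theta>. cmod (f \<theta> - g N \<theta>))) \<longlonglongrightarrow> integral\<^sup>L torus (\<lambda>\<theta>. 0 :: real)"
  proof (rule integral_dominated_convergence[where w = "\<lambda>\<theta>. cmod (f \<theta>)"])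
    show "AE \<theta> in torus. (\<lambda>N. cmod (f \<theta> - g N \<theta>)) \<longlonglongrightarrow> 0"
    proof (rule AE_I2)
      fix \<theta>
      have "\<forall>\<^sub>F N in sequentially. cmod (f \<theta> - g N \<theta>) = 0"
        using eventually_ge_at_top[of "nat \<lceil>cmod (f \<theta>)\<rceil>"]
        by eventually_elim (auto simp: g_def)
      then show "(\<lambda>N. cmod (f \<theta> - g N \<theta>)) \<longlonglongrightarrow> 0"
        by (rule tendsto_eventually)
    qed
  qed (use f in \<open>auto simp: g_def\<close>)
  then have "(\<lambda>N. integral\<^sup>L torus (\<lambda>\<theta>. cmod (f \<theta> - g N \<theta>))) \<longlonglongrightarrow> 0" by simp
  then have "\<forall>\<^sub>F N in sequentially. integral\<^sup>L torus (\<lambda>\<theta>. cmod (f \<theta> - g N \<theta>)) < \<eta> * (2 * pi)"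
    using \<open>\<eta> > 0\<close> by (intro order_tendstoD(2)) auto
  then obtain N where "integral\<^sup>L torus (\<lambda>\<theta>. cmod (f \<theta> - g N \<theta>)) < \<eta> * (2 * pi)"
    by (auto simp: eventually_sequentially)
  then have "L1_mean (\<lambda>\<theta>. f \<theta> - g N \<theta>) \<le> \<eta>"
    by (simp add: L1_mean_def field_simps)
  then show thesis
    by (intro that[of "g N" "real N"]) (auto simp: g_def)
qed

section \<open>Toeplitz matrices restricted to diagonal blocks\<close>

text \<open>
  \<open>\<beta>\<close> assigns a block label to each index; entries survive only within a block with label below \<open>m\<close>.
  A full Toeplitz matrix (one block) and \<open>LT\<^sub>n\<^sup>m(1, h)\<close> (labels \<open>i div (n div m)\<close>, where the
  leftover indices get labels from \<open>m\<close> on) are both of this form, so that one estimate serves both.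
\<close>

definition block_toeplitz ::
    "nat \<Rightarrow> (nat \<Rightarrow> nat) \<Rightarrow> nat \<Rightarrow> (real \<Rightarrow> complex) \<Rightarrow> complex mat" where
  "block_toeplitz n \<beta> m h = mat n n (\<lambda>(i, j).
     if \<beta> i = \<beta> j \<and> \<beta> i < m then fourier_coeff h (int i - int j) else 0)"

lemma block_toeplitz_carrier [simp]: "block_toeplitz n \<beta> m h \<in> carrier_mat n n"
  by (simp add: block_toeplitz_def)

lemma toeplitz_eq_block_toeplitz: "toeplitz n h = block_toeplitz n (\<lambda>_. 0) 1 h"
  by (simp add: toeplitz_def block_toeplitz_def)

lemma block_toeplitz_add:
  assumes "integrable torus f" "integrable torus g"
  shows "block_toeplitz n \<beta> m (\<lambda>\<theta>. f \<theta> + g \<theta>) = block_toeplitz n \<beta> m f + block_toeplitz n \<beta> m g"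
  unfolding block_toeplitz_def by (intro eq_matI) (auto simp: fourier_coeff_add[OF assms])

lemma block_toeplitz_mult:
  "block_toeplitz n \<beta> m (\<lambda>\<theta>. a * f \<theta>) = a \<cdot>\<^sub>m block_toeplitz n \<beta> m f"
  unfolding block_toeplitz_def by (intro eq_matI) (auto simp: fourier_coeff_mult)

lemma sum_same_block:
  fixes F G :: "nat \<Rightarrow> complex" and \<beta> :: "nat \<Rightarrow> nat" and m n :: nat
  shows "(\<Sum>i<n. \<Sum>j<n. if \<beta> i = \<beta> j \<and> \<beta> i < m then F i * G j else 0)
       = (\<Sum>b<m. (\<Sum>i<n. if \<beta> i = b then F i else 0) * (\<Sum>j<n. if \<beta> j = b then G j else 0))"
proof -
  have "(\<Sum>b<m. (\<Sum>i<n. if \<beta> i = b then F i else 0) * (\<Sum>j<n. if \<beta> j = b then G j else 0))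
      = (\<Sum>b<m. \<Sum>i<n. \<Sum>j<n. (if \<beta> i = b then F i else 0) * (if \<beta> j = b then G j else 0))"
    by (simp add: sum_product)
  also have "\<dots> = (\<Sum>i<n. \<Sum>b<m. \<Sum>j<n. (if \<beta> i = b then F i else 0) * (if \<beta> j = b then G j else 0))"
    by (rule sum.swap)
  also have "\<dots> = (\<Sum>i<n. \<Sum>j<n. \<Sum>b<m. (if \<beta> i = b then F i else 0) * (if \<beta> j = b then G j else 0))"
    by (rule sum.cong[OF refl], rule sum.swap)
  also have "\<dots> = (\<Sum>i<n. \<Sum>j<n. if \<beta> i = \<beta> j \<and> \<beta> i < m then F i * G j else 0)"
  proof (intro sum.cong refl)
    fix i j
    have "(\<Sum>b<m. (if \<beta> i = b then F i else 0) * (if \<beta> j = b then G j else 0))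
        = (\<Sum>b<m. if \<beta> i = b then (if \<beta> i = \<beta> j then F i * G j else 0) else 0)"
      by (intro sum.cong refl) auto
    also have "\<dots> = (if \<beta> i = \<beta> j \<and> \<beta> i < m then F i * G j else 0)"
      by simp
    finally show "(\<Sum>b<m. (if \<beta> i = b then F i else 0) * (if \<beta> j = b then G j else 0))
        = (if \<beta> i = \<beta> j \<and> \<beta> i < m then F i * G j else 0)" .
  qed
  finally show ?thesis ..
qed

text \<open>
  The entry with indices \<open>i\<close> and \<open>j\<close> integrates \<open>h\<close> against \<open>character i * cnj (character j)\<close>, so
  under the integral the double sum over each block factors into the squared modulus of a
  trigonometric polynomial.  This exhibits the form as nonnegative when \<open>h\<close> is.
\<close>

lemma sesq_block_toeplitz:
  fixes h :: "real \<Rightarrow> real"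
  assumes h: "integrable torus h"
  shows "sesq n (block_toeplitz n \<beta> m (\<lambda>\<theta>. of_real (h \<theta>))) z z
     = of_real (integral\<^sup>L torus (\<lambda>\<theta>. h \<theta> *
         (\<Sum>b<m. (cmod (\<Sum>i<n. if \<beta> i = b then cnj (z i) * character (int i) \<theta> else 0))\<^sup>2)) / (2 * pi))"
proof -
  define c where "c i j = (if \<beta> i = \<beta> j \<and> \<beta> i < m then cnj (z i) * z j else 0)" for i j
  have hc: "integrable torus (\<lambda>\<theta>. complex_of_real (h \<theta>))" using h by simp
  have "sesq n (block_toeplitz n \<beta> m (\<lambda>\<theta>. of_real (h \<theta>))) z z
      = (\<Sum>i<n. \<Sum>j<n. c i j * fourier_coeff (\<lambda>\<theta>. of_real (h \<theta>)) (int i - int j))"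
    unfolding sesq_def block_toeplitz_def c_def by (intro sum.cong refl) auto
  also have "\<dots> = (\<Sum>i<n. \<Sum>j<n. c i j * integral\<^sup>L torus (\<lambda>\<theta>. of_real (h \<theta>) * character (int i - int j) \<theta>))
      / of_real (2 * pi)"
    by (simp add: fourier_coeff_eq sum_divide_distrib)
  also have "(\<Sum>i<n. \<Sum>j<n. c i j * integral\<^sup>L torus (\<lambda>\<theta>. of_real (h \<theta>) * character (int i - int j) \<theta>))
      = integral\<^sup>L torus (\<lambda>\<theta>. \<Sum>i<n. \<Sum>j<n. c i j * (of_real (h \<theta>) * character (int i - int j) \<theta>))"
    using integrable_mult_character[OF hc] by simp
  also have "(\<lambda>\<theta>. \<Sum>i<n. \<Sum>j<n. c i j * (of_real (h \<theta>) * character (int i - int j) \<theta>))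
      = (\<lambda>\<theta>. of_real (h \<theta> *
         (\<Sum>b<m. (cmod (\<Sum>i<n. if \<beta> i = b then cnj (z i) * character (int i) \<theta> else 0))\<^sup>2)))"
  proof
    fix \<theta>
    define F where "F i = cnj (z i) * character (int i) \<theta>" for i
    have "(\<Sum>i<n. \<Sum>j<n. c i j * (of_real (h \<theta>) * character (int i - int j) \<theta>))
        = of_real (h \<theta>) * (\<Sum>i<n. \<Sum>j<n. if \<beta> i = \<beta> j \<and> \<beta> i < m then F i * cnj (F j) else 0)"
      unfolding sum_distrib_left c_def F_def character_diff
      by (intro sum.cong refl) (auto simp: algebra_simps)
    also have "(\<Sum>i<n. \<Sum>j<n. if \<beta> i = \<beta> j \<and> \<beta> i < m then F i * cnj (F j) else 0)
        = (\<Sum>b<m. (\<Sum>i<n. if \<beta> i = b then F i else 0) * (\<Sum>j<n. if \<beta> j = b then cnj (F j) else 0))"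
      by (rule sum_same_block)
    also have "\<dots> = (\<Sum>b<m. of_real ((cmod (\<Sum>i<n. if \<beta> i = b then F i else 0))\<^sup>2))"
      unfolding complex_norm_square by (simp add: if_distrib[of cnj] cong: if_cong)
    finally show "(\<Sum>i<n. \<Sum>j<n. c i j * (of_real (h \<theta>) * character (int i - int j) \<theta>))
      = of_real (h \<theta> *
         (\<Sum>b<m. (cmod (\<Sum>i<n. if \<beta> i = b then cnj (z i) * character (int i) \<theta> else 0))\<^sup>2))"
      unfolding F_def by simp
  qed
  finally show ?thesis
    by (simp only: integral_complex_of_real of_real_divide)
qed

lemma pos_semidef_block_toeplitz:
  fixes h :: "real \<Rightarrow> real"
  assumes h: "integrable torus h" and nonneg: "\<And>\<theta>. 0 \<le> h \<theta>"
  shows "pos_semidef n (block_toeplitz n \<beta> m (\<lambda>\<theta>. of_real (h \<theta>)))"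
  unfolding pos_semidef_def
proof (intro conjI allI impI)
  fix z
  show "0 \<le> Re (sesq n (block_toeplitz n \<beta> m (\<lambda>\<theta>. of_real (h \<theta>))) z z)"
    unfolding sesq_block_toeplitz[OF h] Re_complex_of_real
    using nonneg by (intro divide_nonneg_pos integral_nonneg_AE AE_I2 mult_nonneg_nonneg sum_nonneg) auto
next
  fix i j assume ij: "i < n" "j < n"
  have "fourier_coeff (\<lambda>\<theta>. of_real (h \<theta>)) (- k) = cnj (fourier_coeff (\<lambda>\<theta>. of_real (h \<theta>)) k)" for k
  proof -
    have "cnj (integral\<^sup>L torus (\<lambda>\<theta>. complex_of_real (h \<theta>) * character k \<theta>))
        = integral\<^sup>L torus (\<lambda>\<theta>. cnj (complex_of_real (h \<theta>) * character k \<theta>))"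
      by (rule Bochner_Integration.integral_cnj[symmetric])
    then show ?thesis
      by (simp add: fourier_coeff_eq cnj_character)
  qed
  from this[of "int i - int j"]
  show "block_toeplitz n \<beta> m (\<lambda>\<theta>. of_real (h \<theta>)) $$ (j, i)
      = cnj (block_toeplitz n \<beta> m (\<lambda>\<theta>. of_real (h \<theta>)) $$ (i, j))"
    using ij by (simp add: block_toeplitz_def)
qed simp

lemma re_trace_block_toeplitz:
  fixes h :: "real \<Rightarrow> real"
  assumes nonneg: "\<And>\<theta>. 0 \<le> h \<theta>"
  shows "re_trace n (block_toeplitz n \<beta> m (\<lambda>\<theta>. of_real (h \<theta>))) \<le> real n * L1_mean (\<lambda>\<theta>. of_real (h \<theta>))"
proof -
  have eq: "fourier_coeff (\<lambda>\<theta>. of_real (h \<theta>)) 0 = of_real (L1_mean (\<lambda>\<theta>. of_real (h \<theta>)))"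
    using nonneg by (simp add: fourier_coeff_eq L1_mean_def)
  have "0 \<le> L1_mean (\<lambda>\<theta>. of_real (h \<theta>))"
    by (simp add: L1_mean_def)
  then have "re_trace n (block_toeplitz n \<beta> m (\<lambda>\<theta>. of_real (h \<theta>)))
      \<le> (\<Sum>i<n. L1_mean (\<lambda>\<theta>. of_real (h \<theta>)))"
    unfolding re_trace_def by (intro sum_mono) (simp add: block_toeplitz_def eq)
  then show ?thesis by simp
qed

lemma L1_mean_mono:
  assumes "integrable torus g" "f \<in> borel_measurable torus" "\<And>\<theta>. cmod (f \<theta>) \<le> cmod (g \<theta>)"
  shows "L1_mean f \<le> L1_mean g"
proof -
  have "integrable torus f"
    using assms(1,2) by (rule Bochner_Integration.integrable_bound) (simp add: assms(3))
  then show ?thesis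
    unfolding L1_mean_def using assms by (intro divide_right_mono integral_mono) auto
qed

lemma low_rank_plus_small_block_toeplitz_nonneg:
  fixes h :: "real \<Rightarrow> real"
  assumes g: "integrable torus g" and [measurable]: "h \<in> borel_measurable torus"
    and h: "\<And>\<theta>. 0 \<le> h \<theta>" "\<And>\<theta>. h \<theta> \<le> cmod (g \<theta>)" and "\<delta> > 0" "cmod a \<le> 1"
  shows "integrable torus (\<lambda>\<theta>. a * of_real (h \<theta>))"
    and "low_rank_plus_small n (real n * L1_mean g / \<delta>) \<delta> (block_toeplitz n \<beta> m (\<lambda>\<theta>. a * of_real (h \<theta>)))"
proof -
  have int: "integrable torus h"
    using g by (rule Bochner_Integration.integrable_bound) (use h in auto)
  then show "integrable torus (\<lambda>\<theta>. a * of_real (h \<theta>))" by simp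
  have "re_trace n (block_toeplitz n \<beta> m (\<lambda>\<theta>. of_real (h \<theta>))) \<le> real n * L1_mean (\<lambda>\<theta>. of_real (h \<theta>))"
    using h(1) by (rule re_trace_block_toeplitz)
  also have "\<dots> \<le> real n * L1_mean g"
    using g h by (intro mult_left_mono L1_mean_mono) auto
  finally have "re_trace n (block_toeplitz n \<beta> m (\<lambda>\<theta>. of_real (h \<theta>))) / \<delta> \<le> real n * L1_mean g / \<delta>"
    using \<open>\<delta> > 0\<close> by (simp add: divide_right_mono)
  from low_rank_plus_small_mono[OF low_rank_plus_small_pos_semidef[OF
      pos_semidef_block_toeplitz[OF int h(1)] \<open>\<delta> > 0\<close>] this order_refl]
  have "low_rank_plus_small n (real n * L1_mean g / \<delta>) \<delta> (block_toeplitz n \<beta> m (\<lambda>\<theta>. of_real (h \<theta>)))" .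
  then show "low_rank_plus_small n (real n * L1_mean g / \<delta>) \<delta> (block_toeplitz n \<beta> m (\<lambda>\<theta>. a * of_real (h \<theta>)))"
    unfolding block_toeplitz_mult using \<open>cmod a \<le> 1\<close> \<open>\<delta> > 0\<close>
    by (intro low_rank_plus_small_smult) auto
qed

text \<open>
  The positive and negative parts of \<open>Re g\<close> and \<open>Im g\<close> are nonnegative and dominated by \<open>\<bar>g\<bar>\<close>;
  each contributes one quarter of the bounds.
\<close>

lemma low_rank_plus_small_block_toeplitz:
  assumes g: "integrable torus g" and "\<delta> > 0"
  shows "low_rank_plus_small n (4 * (real n * L1_mean g / \<delta>)) (4 * \<delta>) (block_toeplitz n \<beta> m g)"
proof -
  have [measurable]: "g \<in> borel_measurable torus" using g by simp
  have [measurable]: "(\<lambda>\<theta>. Re (g \<theta>)) \<in> borel_measurable torus" "(\<lambda>\<theta>. Im (g \<theta>)) \<in> borel_measurable torus"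
    by measurable
  let ?p = "\<lambda>a u \<theta>. a * complex_of_real (max 0 (u \<theta>))"
  define p1 where "p1 = ?p 1 (\<lambda>\<theta>. Re (g \<theta>))"
  define p2 where "p2 = ?p (-1) (\<lambda>\<theta>. - Re (g \<theta>))"
  define p3 where "p3 = ?p \<i> (\<lambda>\<theta>. Im (g \<theta>))"
  define p4 where "p4 = ?p (-\<i>) (\<lambda>\<theta>. - Im (g \<theta>))"
  have g_eq: "g = (\<lambda>\<theta>. p1 \<theta> + (p2 \<theta> + (p3 \<theta> + p4 \<theta>)))"
    by (auto simp: p1_def p2_def p3_def p4_def complex_eq_iff max_def)
  have bnd: "Re z \<le> cmod z" "- Re z \<le> cmod z" "Im z \<le> cmod z" "- Im z \<le> cmod z" for z
    using abs_Re_le_cmod[of z] abs_Im_le_cmod[of z] by linarith+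
  note * = low_rank_plus_small_block_toeplitz_nonneg[OF g _ _ _ \<open>\<delta> > 0\<close>]
  have int: "integrable torus p1" "integrable torus p2" "integrable torus p3" "integrable torus p4"
    unfolding p1_def p2_def p3_def p4_def by (rule *(1); simp add: bnd)+
  have small: "low_rank_plus_small n (real n * L1_mean g / \<delta>) \<delta> (block_toeplitz n \<beta> m p1)"
    "low_rank_plus_small n (real n * L1_mean g / \<delta>) \<delta> (block_toeplitz n \<beta> m p2)"
    "low_rank_plus_small n (real n * L1_mean g / \<delta>) \<delta> (block_toeplitz n \<beta> m p3)"
    "low_rank_plus_small n (real n * L1_mean g / \<delta>) \<delta> (block_toeplitz n \<beta> m p4)"
    unfolding p1_def p2_def p3_def p4_def by (rule *(2); simp add: bnd)+
  have "block_toeplitz n \<beta> m g = block_toeplitz n \<beta> m p1 +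
      (block_toeplitz n \<beta> m p2 + (block_toeplitz n \<beta> m p3 + block_toeplitz n \<beta> m p4))"
    by (subst g_eq) (simp only: block_toeplitz_add int Bochner_Integration.integrable_add)
  then show ?thesis
    using low_rank_plus_small_add[OF small(1) low_rank_plus_small_add[OF small(2)
        low_rank_plus_small_add[OF small(3) small(4)]]]
    by (simp add: algebra_simps)
qed

lemma card_near_multiples:
  fixes q :: nat
  shows "card (\<Union>b\<le>m. {i :: nat. \<bar>int i - int (b * q)\<bar> \<le> int L}) \<le> Suc m * (2 * L + 1)"
    and "finite (\<Union>b\<le>m. {i :: nat. \<bar>int i - int (b * q)\<bar> \<le> int L})"
proof -
  have sub: "{i :: nat. \<bar>int i - int c\<bar> \<le> int L} \<subseteq> {c - L..c + L}" for c by auto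
  have card: "card {i :: nat. \<bar>int i - int c\<bar> \<le> int L} \<le> 2 * L + 1" for c
    using card_mono[OF _ sub[of c]] by simp
  have "card (\<Union>b\<le>m. {i :: nat. \<bar>int i - int (b * q)\<bar> \<le> int L})
      \<le> (\<Sum>b\<le>m. card {i :: nat. \<bar>int i - int (b * q)\<bar> \<le> int L})"
    by (rule card_UN_le) simp
  also have "\<dots> \<le> (\<Sum>b\<le>m. 2 * L + 1)"
    by (intro sum_mono card)
  finally show "card (\<Union>b\<le>m. {i :: nat. \<bar>int i - int (b * q)\<bar> \<le> int L}) \<le> Suc m * (2 * L + 1)"
    by simp
  show "finite (\<Union>b\<le>m. {i :: nat. \<bar>int i - int (b * q)\<bar> \<le> int L})"
    by (intro finite_UN_I finite_atMost) (rule finite_subset[OF sub], simp)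
qed

text \<open>
  An entry that is close to the diagonal but outside the blocks lies in a row near a block boundary
  \<open>b * q\<close>.  The rows after the last block are fewer than \<open>m\<close>, hence also near the boundary
  \<open>m * q\<close>; this is why the distance is \<open>K + m\<close>.
\<close>

lemma off_block_near_multiple:
  fixes n m i j :: nat
  defines "q \<equiv> n div m"
  assumes "0 < m" "m \<le> n" "i < n" "\<bar>int i - int j\<bar> \<le> int K"
    and off: "\<not> (i div q = j div q \<and> i div q < m)"
  shows "\<exists>b\<le>m. \<bar>int i - int (b * q)\<bar> \<le> int (K + m)"
proof -
  have q: "0 < q" using assms by (simp add: q_def div_greater_zero_iff)
  show ?thesis
  proof (cases "i div q < m")
    case False
    then have "m * q \<le> i" using q by (simp add: less_eq_div_iff_mult_less_eq not_less)
    moreover have "i < m * q + m"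
      using \<open>i < n\<close> \<open>0 < m\<close> unfolding q_def
      by (metis add_strict_left_mono div_mult_mod_eq less_trans mod_less_divisor mult.commute)
    ultimately show ?thesis by (intro exI[of _ m] conjI) linarith+
  next
    case True
    define b where "b = i div q"
    have b: "b * q \<le> i" "i < (b + 1) * q"
      using q by (simp_all add: b_def div_times_less_eq_dividend dividend_less_div_times)
    have "j < b * q \<or> (b + 1) * q \<le> j"
    proof (rule ccontr)
      assume "\<not> ?thesis"
      then have "j div q = b"
        by (intro div_nat_eqI) (auto simp: algebra_simps)
      then show False using off True by (simp add: b_def)
    qed
    then show ?thesis
    proof
      assume "j < b * q"
      then have "\<bar>int i - int (b * q)\<bar> \<le> int (K + m)"
        using b(1) \<open>\<bar>int i - int j\<bar> \<le> int K\<close> by linarith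
      then show ?thesis using True by (intro exI[of _ b] conjI) (simp_all only: b_def less_imp_le)
    next
      assume "(b + 1) * q \<le> j"
      then have "\<bar>int i - int ((b + 1) * q)\<bar> \<le> int (K + m)"
        using b(2) \<open>\<bar>int i - int j\<bar> \<le> int K\<close> by linarith
      moreover have "b + 1 \<le> m" using True by (simp add: b_def)
      ultimately show ?thesis by blast
    qed
  qed
qed

text \<open>
  The entries at distance more than \<open>K\<close> from the diagonal contribute at most \<open>e / 2\<close> per row, by the
  choice of \<open>K\<close>.  The other entries outside the blocks lie in a number of rows that is bounded
  independently of \<open>n\<close>, and each row contributes at most \<open>M\<^sup>2\<close> by Bessel's inequality.
\<close>

lemma toeplitz_minus_block_toeplitz_frobenius:
  assumes g: "g \<in> borel_measurable torus" "\<And>\<theta>. cmod (g \<theta>) \<le> M" and "0 < m" "e > 0"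
  shows "\<forall>\<^sub>F n in sequentially.
    frobenius_sq n (toeplitz n g - block_toeplitz n (\<lambda>i. i div (n div m)) m g) \<le> e * real n"
proof -
  define a where "a k = (cmod (fourier_coeff g k))\<^sup>2" for k
  have a0: "0 \<le> a k" for k by (simp add: a_def)
  have "0 < e / 2" using \<open>e > 0\<close> by simp
  then obtain K where K: "\<forall>L. finite L \<and> (\<forall>k\<in>L. \<bar>k\<bar> > int K) \<longrightarrow> sum a L \<le> e / 2"
    unfolding a_def by (rule fourier_coeff_square_tail[OF g])
  define C where "C = real (Suc m * (2 * (K + m) + 1)) * M\<^sup>2"
  have diag: "(\<Sum>j | j < n \<and> P j. a (int i - int j)) = sum a ((\<lambda>j. int i - int j) ` {j. j < n \<and> P j})"
    for P and i n :: nat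
    by (subst sum.reindex) (auto simp: inj_on_def)
  have key: "frobenius_sq n (toeplitz n g - block_toeplitz n (\<lambda>i. i div (n div m)) m g) \<le> C + e / 2 * real n"
    if "m \<le> n" for n
  proof -
    define q where "q = n div m"
    define off where "off i j \<longleftrightarrow> \<not> (i div q = j div q \<and> i div q < m)" for i j
    define near where "near = (\<Union>b\<le>m. {i :: nat. \<bar>int i - int (b * q)\<bar> \<le> int (K + m)})"
    have fin: "finite near" and card: "card near \<le> Suc m * (2 * (K + m) + 1)"
      unfolding near_def by (rule card_near_multiples)+
    have "frobenius_sq n (toeplitz n g - block_toeplitz n (\<lambda>i. i div (n div m)) m g)
        = (\<Sum>i<n. \<Sum>j<n. if off i j then a (int i - int j) else 0)"
      unfolding frobenius_sq_def toeplitz_def block_toeplitz_def off_def a_def q_def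
      by (intro sum.cong refl) auto
    also have "\<dots> \<le> (\<Sum>i<n. (if i \<in> near then M\<^sup>2 else 0) + e / 2)"
    proof (rule sum_mono)
      fix i assume "i \<in> {..<n}"
      then have i: "i < n" by simp
      have "(\<Sum>j<n. if off i j then a (int i - int j) else 0)
          \<le> (\<Sum>j<n. (if i \<in> near then if \<bar>int i - int j\<bar> \<le> int K then a (int i - int j) else 0 else 0)
               + (if \<bar>int i - int j\<bar> > int K then a (int i - int j) else 0))"
      proof (rule sum_mono)
        fix j
        have "i \<in> near" if "off i j" "\<bar>int i - int j\<bar> \<le> int K"
          using off_block_near_multiple[OF \<open>0 < m\<close> \<open>m \<le> n\<close> i that(2)] that(1)
          unfolding near_def off_def q_def by auto
        then show "(if off i j then a (int i - int j) else 0)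
          \<le> (if i \<in> near then if \<bar>int i - int j\<bar> \<le> int K then a (int i - int j) else 0 else 0)
               + (if \<bar>int i - int j\<bar> > int K then a (int i - int j) else 0)"
          using a0[of "int i - int j"] by auto
      qed
      also have "\<dots> = (if i \<in> near then \<Sum>j | j < n \<and> \<bar>int i - int j\<bar> \<le> int K. a (int i - int j) else 0)
           + (\<Sum>j | j < n \<and> \<bar>int i - int j\<bar> > int K. a (int i - int j))"
        by (auto simp: sum.distrib sum.If_cases Int_def lessThan_def)
      also have "\<dots> \<le> (if i \<in> near then M\<^sup>2 else 0) + e / 2"
        unfolding diag using Bessel_inequality[OF g] K
        by (intro add_mono) (auto simp: a_def)
      finally show "(\<Sum>j<n. if off i j then a (int i - int j) else 0) \<le> (if i \<in> near then M\<^sup>2 else 0) + e / 2" .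
    qed
    also have "\<dots> = real (card ({..<n} \<inter> near)) * M\<^sup>2 + e / 2 * real n"
      by (simp add: sum.distrib sum.If_cases)
    also have "\<dots> \<le> real (Suc m * (2 * (K + m) + 1)) * M\<^sup>2 + e / 2 * real n"
      using card_mono[OF fin, of "{..<n} \<inter> near"] card
      by (intro add_right_mono mult_right_mono of_nat_mono) auto
    finally show ?thesis by (simp only: C_def)
  qed
  have "\<forall>\<^sub>F n in sequentially. C * 2 / e \<le> real n"
    using eventually_ge_at_top[of "nat \<lceil>C * 2 / e\<rceil>"] by eventually_elim linarith
  then show ?thesis
    using eventually_ge_at_top[of m]
  proof eventually_elim
    case (elim n)
    then have "C \<le> e / 2 * real n" using \<open>e > 0\<close> by (simp add: field_simps)
    then show ?case using key[OF elim(2)] by simp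
  qed
qed

section \<open>Toeplitz sequences are locally Toeplitz\<close>

lemma index_diag_block_mat_replicate:
  assumes "M \<in> carrier_mat q q" "0 < q" "i < m * q + r" "j < m * q + r"
  shows "diag_block_mat (replicate m M @ [0\<^sub>m r r]) $$ (i, j)
       = (if i div q = j div q \<and> i div q < m then M $$ (i mod q, j mod q) else 0)"
  using assms(3,4)
proof (induction m arbitrary: i j)
  case 0
  then show ?case by simp
next
  case (Suc m)
  let ?B = "diag_block_mat (replicate m M @ [0\<^sub>m r r])"
  have dim: "dim_row ?B = m * q + r" "dim_col ?B = m * q + r"
    using assms(1) by (auto simp: dim_diag_block_mat sum_list_replicate)
  have shift: "k div q = Suc ((k - q) div q)" "k mod q = (k - q) mod q" if "q \<le> k" for k
    using that assms(2) by (simp_all add: le_div_geq le_mod_geq)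
  have lhs: "diag_block_mat (replicate (Suc m) M @ [0\<^sub>m r r]) $$ (i, j) =
     (if i < q then if j < q then M $$ (i, j) else 0
      else if j < q then 0 else ?B $$ (i - q, j - q))"
    using Suc.prems assms(1) dim by (auto simp: Let_def)
  show ?case
  proof (cases "i < q \<or> j < q")
    case True
    then show ?thesis
      unfolding lhs using assms(2) shift(1)[of i] shift(1)[of j] by (auto simp: not_less)
  next
    case False
    then have "?B $$ (i - q, j - q) = (if (i - q) div q = (j - q) div q \<and> (i - q) div q < m
        then M $$ ((i - q) mod q, (j - q) mod q) else 0)"
      using Suc.prems by (intro Suc.IH) auto
    then show ?thesis
      unfolding lhs using False shift[of i] shift[of j] by (auto simp: not_less)
  qed
qed

lemma lt_operator_eq_block_toeplitz:
  assumes "0 < m" "m \<le> n"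
  shows "lt_operator n m (\<lambda>_. 1) f = block_toeplitz n (\<lambda>i. i div (n div m)) m f"
proof -
  define q where "q = n div m"
  have q: "0 < q" using assms by (simp add: q_def div_greater_zero_iff)
  have n: "m * q + n mod m = n" by (simp add: q_def)
  have T: "toeplitz q f \<in> carrier_mat q q" by (simp add: toeplitz_def)
  have "(1 :: complex) \<cdot>\<^sub>m toeplitz q f = toeplitz q f" by auto
  then have lt: "lt_operator n m (\<lambda>_. 1) f = diag_block_mat (replicate m (toeplitz q f) @ [0\<^sub>m (n mod m) (n mod m)])"
    by (simp add: lt_operator_def q_def map_replicate_const del: upt_Suc)
  have dims: "dim_row (lt_operator n m (\<lambda>_. 1) f) = n" "dim_col (lt_operator n m (\<lambda>_. 1) f) = n"
    unfolding lt using T n by (auto simp: dim_diag_block_mat sum_list_replicate)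
  show ?thesis
  proof (rule eq_matI)
    fix i j assume "i < dim_row (block_toeplitz n (\<lambda>i. i div (n div m)) m f)"
      "j < dim_col (block_toeplitz n (\<lambda>i. i div (n div m)) m f)"
    then have ij: "i < n" "j < n" by (simp_all add: block_toeplitz_def)
    have "int (i mod q) - int (j mod q) = int i - int j" if "i div q = j div q"
    proof -
      have "int k = int (k div q) * int q + int (k mod q)" for k
        by (metis div_mult_mod_eq of_nat_add of_nat_mult)
      from this[of i] this[of j] that show ?thesis by simp
    qed
    then show "lt_operator n m (\<lambda>_. 1) f $$ (i, j) = block_toeplitz n (\<lambda>i. i div (n div m)) m f $$ (i, j)"
      unfolding lt using index_diag_block_mat_replicate[OF T q, of i m "n mod m" j] ij n q
      by (simp add: block_toeplitz_def toeplitz_def q_def[symmetric])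
  qed (simp_all add: dims block_toeplitz_def)
qed

lemma riemann_integrable_01_const: "riemann_integrable_01 (\<lambda>_. a)"
  unfolding riemann_integrable_01_def
proof (intro exI[of _ a] allI impI exI[of _ 1] conjI)
  fix \<epsilon> :: real and p :: "(real \<times> real set) set"
  assume "\<epsilon> > 0" and p: "p tagged_division_of cbox 0 1 \<and> (\<lambda>x. ball x 1) fine p"
  have "(\<Sum>(x, K)\<in>p. Henstock_Kurzweil_Integration.content K *\<^sub>R a)
      = (\<Sum>(x, K)\<in>p. Henstock_Kurzweil_Integration.content K) *\<^sub>R a"
    by (simp add: scaleR_sum_left split_beta)
  also have "(\<Sum>(x, K)\<in>p. Henstock_Kurzweil_Integration.content K)
      = Henstock_Kurzweil_Integration.content (cbox 0 (1 :: real))"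
    using p by (intro additive_content_tagged_division) auto
  finally show "cmod ((\<Sum>(x, K)\<in>p. Henstock_Kurzweil_Integration.content K *\<^sub>R a) - a) < \<epsilon>"
    using \<open>\<epsilon> > 0\<close> by simp
qed simp

lemma acsI_low_rank_plus_small:
  assumes "\<epsilon> \<longlonglongrightarrow> 0" and A: "\<And>n. A n \<in> carrier_mat n n"
    and diff: "\<And>m. \<forall>\<^sub>F n in sequentially. B m n \<in> carrier_mat n n \<and>
       low_rank_plus_small n (\<epsilon> m * real n) (\<epsilon> m) (A n - B m n)"
  shows "acs B A"
proof -
  have "\<exists>n\<^sub>0. \<forall>m. \<forall>n\<ge>n\<^sub>0 m. B m n \<in> carrier_mat n n \<and>
       low_rank_plus_small n (\<epsilon> m * real n) (\<epsilon> m) (A n - B m n)"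
    using diff unfolding eventually_sequentially by (intro choice allI)
  then obtain n\<^sub>0 where n\<^sub>0: "\<And>m n. n\<^sub>0 m \<le> n \<Longrightarrow> B m n \<in> carrier_mat n n"
      "\<And>m n. n\<^sub>0 m \<le> n \<Longrightarrow> low_rank_plus_small n (\<epsilon> m * real n) (\<epsilon> m) (A n - B m n)"
    by blast
  have "\<exists>R \<in> carrier_mat n n. \<exists>N \<in> carrier_mat n n. A n = B m n + R + N \<and>
      real (vec_space.rank n R) \<le> \<epsilon> m * real n \<and> spectral_norm N \<le> \<epsilon> m"
    if n: "n\<^sub>0 m \<le> n" "n > 0" for m n
  proof -
    obtain R N where RN: "R \<in> carrier_mat n n" "N \<in> carrier_mat n n" "A n - B m n = R + N"
      "real (vec_space.rank n R) \<le> \<epsilon> m * real n" "spectral_norm N \<le> \<epsilon> m"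
      using low_rank_plus_small_spectral_norm[OF n\<^sub>0(2)[OF n(1)] n(2)] by blast
    have B: "B m n \<in> carrier_mat n n" using n\<^sub>0(1)[OF n(1)] .
    have "A n = B m n + (A n - B m n)" using A[of n] B by (intro eq_matI) auto
    also have "\<dots> = B m n + R + N"
      unfolding RN(3) using B RN(1,2) by (simp add: assoc_add_mat[of _ n n])
    finally show ?thesis using RN by auto
  qed
  then show ?thesis
    unfolding acs_def using \<open>\<epsilon> \<longlonglongrightarrow> 0\<close> by blast
qed

lemma acs_refl:
  assumes "\<And>n. A n \<in> carrier_mat n n"
  shows "acs (\<lambda>m. A) A"
proof (rule acsI_low_rank_plus_small[where \<epsilon> = "\<lambda>_. 0"])
  have "low_rank_plus_small n 0 0 (A n - A n)" for n
    using assms[of n] by (intro low_rank_plus_small_low_rank) (auto simp: vec_space.rank_0I)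
  then show "\<forall>\<^sub>F n in sequentially. A n \<in> carrier_mat n n \<and> low_rank_plus_small n (0 * real n) 0 (A n - A n)"
    using assms by simp
qed (use assms in auto)

text \<open>
  With \<open>f = g + u\<close>, the difference \<open>T\<^sub>n(f + h n) - LT\<^sub>n\<^sup>m(1, f)\<close> is the sum of the four matrices
  \<open>D = T\<^sub>n(g) - LT\<^sub>n\<^sup>m(1, g)\<close>, \<open>U = T\<^sub>n(u)\<close>, \<open>W = - LT\<^sub>n\<^sup>m(1, u)\<close> and \<open>H = T\<^sub>n(h n)\<close>, each
  of which may use a quarter of the budget \<open>\<epsilon> m\<close> for rank and norm.
\<close>

lemma acs_lt_operator_toeplitz:
  assumes f: "integrable torus f" and h: "\<And>n. integrable torus (h n)"
    and h_tendsto: "(\<lambda>n. L1_mean (h n)) \<longlonglongrightarrow> 0"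
  shows "acs (\<lambda>m n. lt_operator n m (\<lambda>_. 1) f) (\<lambda>n. toeplitz n (\<lambda>\<theta>. f \<theta> + h n \<theta>))"
proof -
  define \<epsilon> where "\<epsilon> m = 1 / (real m + 1)" for m :: nat
  have \<epsilon>_pos: "\<epsilon> m > 0" for m by (simp add: \<epsilon>_def)
  have \<epsilon>_tendsto: "\<epsilon> \<longlonglongrightarrow> 0"
    using LIMSEQ_Suc[OF lim_1_over_n] by (simp add: \<epsilon>_def[abs_def] add.commute)
  have "\<forall>\<^sub>F n in sequentially. lt_operator n m (\<lambda>_. 1) f \<in> carrier_mat n n \<and>
      low_rank_plus_small n (\<epsilon> m * real n) (\<epsilon> m)
        (toeplitz n (\<lambda>\<theta>. f \<theta> + h n \<theta>) - lt_operator n m (\<lambda>_. 1) f)" for m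
  proof (cases "m = 0")
    case True
    \<comment> \<open>There are no blocks, but \<open>\<epsilon> 0 = 1\<close> permits a correction of full rank.\<close>
    have lt: "lt_operator n m (\<lambda>_. 1) f = 0\<^sub>m n n" for n
      using True by (simp add: lt_operator_def)
    have "low_rank_plus_small n (\<epsilon> m * real n) (\<epsilon> m) (T - 0\<^sub>m n n)" if T: "T \<in> carrier_mat n n" for n T
    proof (rule low_rank_plus_small_low_rank)
      show T': "T - 0\<^sub>m n n \<in> carrier_mat n n" by (rule minus_carrier_mat) simp
      show "real (vec_space.rank n (T - 0\<^sub>m n n)) \<le> \<epsilon> m * real n"
        using vec_space.rank_le_nc[OF T'] True by (simp add: \<epsilon>_def)
      show "0 \<le> \<epsilon> m" using \<epsilon>_pos[of m] by simp
    qed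
    then show ?thesis unfolding lt by (simp add: toeplitz_def)
  next
    case False
    then have "0 < m" by simp
    \<comment> \<open>Four parts of norm at most \<open>\<delta>\<close> make \<open>4 * \<delta> = \<epsilon> m / 4\<close>, and an \<open>L\<^sup>1\<close> mean of at most \<open>\<eta>\<close>
        makes the rank at most \<open>4 * (n * \<eta> / \<delta>) = \<epsilon> m / 4 * n\<close>.\<close>
    define \<delta> where "\<delta> = \<epsilon> m / 16"
    define \<eta> where "\<eta> = \<epsilon> m * \<delta> / 16"
    have pos: "\<delta> > 0" "\<eta> > 0" using \<epsilon>_pos[of m] by (simp_all add: \<delta>_def \<eta>_def)
    obtain g M where g: "g \<in> borel_measurable torus" "\<And>\<theta>. cmod (g \<theta>) \<le> M"
        "L1_mean (\<lambda>\<theta>. f \<theta> - g \<theta>) \<le> \<eta>"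
      using L1_truncation[OF f \<open>\<eta> > 0\<close>] by metis
    have g_int: "integrable torus g" using g by (intro integrable_torus_bounded)
    define u where "u = (\<lambda>\<theta>. f \<theta> - g \<theta>)"
    have u_int: "integrable torus u" using f g_int by (simp add: u_def)
    have u_mean: "L1_mean u \<le> \<eta>" using g(3) by (simp add: u_def)
    have f_eq: "f = (\<lambda>\<theta>. g \<theta> + u \<theta>)" by (simp add: u_def)
    have small: "low_rank_plus_small n (\<epsilon> m / 4 * real n) (\<epsilon> m / 4) (block_toeplitz n \<beta> k w)"
      if w: "integrable torus w" "L1_mean w \<le> \<eta>" for n \<beta> k w
    proof (rule low_rank_plus_small_mono[OF low_rank_plus_small_block_toeplitz[OF w(1) \<open>\<delta> > 0\<close>]])
      have "4 * (real n * L1_mean w / \<delta>) \<le> 4 * (real n * \<eta> / \<delta>)"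
        using w(2) pos by (intro mult_left_mono divide_right_mono) auto
      also have "\<dots> = \<epsilon> m / 4 * real n" using pos by (simp add: \<eta>_def)
      finally show "4 * (real n * L1_mean w / \<delta>) \<le> \<epsilon> m / 4 * real n" .
    qed (simp add: \<delta>_def)
    have "\<forall>\<^sub>F n in sequentially. L1_mean (h n) < \<eta>"
      using order_tendstoD(2)[OF h_tendsto \<open>\<eta> > 0\<close>] .
    moreover have "\<forall>\<^sub>F n in sequentially. frobenius_sq n
        (toeplitz n g - block_toeplitz n (\<lambda>i. i div (n div m)) m g) \<le> (\<epsilon> m / 4 * (\<epsilon> m / 4)\<^sup>2) * real n"
      using toeplitz_minus_block_toeplitz_frobenius[OF g(1,2) \<open>0 < m\<close>, of "\<epsilon> m / 4 * (\<epsilon> m / 4)\<^sup>2"] \<epsilon>_pos[of m]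
      by simp
    ultimately show ?thesis
      using eventually_ge_at_top[of m]
    proof eventually_elim
      case (elim n)
      define \<beta> where "\<beta> = (\<lambda>i. i div (n div m))"
      define D where "D = toeplitz n g - block_toeplitz n \<beta> m g"
      define U where "U = toeplitz n u"
      define W where "W = (-1) \<cdot>\<^sub>m block_toeplitz n \<beta> m u"
      define H where "H = toeplitz n (h n)"
      define L where "L = lt_operator n m (\<lambda>_. 1) f"
      have L: "L = block_toeplitz n \<beta> m g + block_toeplitz n \<beta> m u"
        unfolding L_def lt_operator_eq_block_toeplitz[OF \<open>0 < m\<close> elim(3)] \<beta>_def
        by (subst f_eq) (rule block_toeplitz_add[OF g_int u_int])
      have T: "toeplitz n (\<lambda>\<theta>. f \<theta> + h n \<theta>) = toeplitz n g + U + H"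
        unfolding U_def H_def toeplitz_eq_block_toeplitz
        by (subst f_eq) (simp only: block_toeplitz_add g_int u_int h Bochner_Integration.integrable_add)
      have carrier: "toeplitz n g \<in> carrier_mat n n" "block_toeplitz n \<beta> m g \<in> carrier_mat n n"
        "block_toeplitz n \<beta> m u \<in> carrier_mat n n" "U \<in> carrier_mat n n" "H \<in> carrier_mat n n"
        by (simp_all add: toeplitz_def U_def H_def)
      have D: "low_rank_plus_small n (\<epsilon> m / 4 * real n) (\<epsilon> m / 4) D"
      proof (rule low_rank_plus_small_mono[OF low_rank_plus_small_frobenius])
        show "D \<in> carrier_mat n n" unfolding D_def using carrier by (intro minus_carrier_mat)
        show "0 < \<epsilon> m / 4" using \<epsilon>_pos[of m] by simp
        show "frobenius_sq n D / (\<epsilon> m / 4)\<^sup>2 \<le> \<epsilon> m / 4 * real n"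
          using elim(2) \<epsilon>_pos[of m] unfolding D_def \<beta>_def by (subst pos_divide_le_eq) (auto simp: mult_ac)
      qed simp
      have U: "low_rank_plus_small n (\<epsilon> m / 4 * real n) (\<epsilon> m / 4) U"
        unfolding U_def toeplitz_eq_block_toeplitz by (rule small[OF u_int u_mean])
      have H: "low_rank_plus_small n (\<epsilon> m / 4 * real n) (\<epsilon> m / 4) H"
        unfolding H_def toeplitz_eq_block_toeplitz using elim(1) by (intro small h) simp
      have W: "low_rank_plus_small n (\<epsilon> m / 4 * real n) (\<epsilon> m / 4) W"
        unfolding W_def using \<epsilon>_pos[of m] by (intro low_rank_plus_small_smult small u_int u_mean) auto
      have "low_rank_plus_small n (\<epsilon> m * real n) (\<epsilon> m) (D + (U + (W + H)))"
        by (rule low_rank_plus_small_mono[OF low_rank_plus_small_add[OF D low_rank_plus_small_add[OF U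
            low_rank_plus_small_add[OF W H]]]]) (simp_all add: algebra_simps)
      moreover have "toeplitz n (\<lambda>\<theta>. f \<theta> + h n \<theta>) - L = D + (U + (W + H))"
        unfolding T L D_def W_def
        using carrier[THEN carrier_matD(1)] carrier[THEN carrier_matD(2)] by (intro eq_matI) auto
      moreover have "L \<in> carrier_mat n n" unfolding L using carrier by simp
      ultimately show ?case unfolding L_def by simp
    qed
  qed
  then show ?thesis
    using \<epsilon>_tendsto by (intro acsI_low_rank_plus_small) (auto simp: toeplitz_def)
qed

text \<open>
  A Lebesgue set is a Borel set up to part of a Borel null set, and cylinders over Borel null sets are
  null.
\<close>

lemma lebesgue_sets_UNIV_Times:
  fixes B :: "real set"
  assumes "B \<in> sets lebesgue"
  shows "(UNIV :: real set) \<times> B \<in> sets lebesgue"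
proof -
  obtain S N N' where SN: "B = S \<union> N" "N \<subseteq> N'" "N' \<in> null_sets lborel" "S \<in> sets lborel"
    using assms by (rule sets_completionE)
  have "(UNIV :: real set) \<times> B = UNIV \<times> S \<union> UNIV \<times> N" "(UNIV :: real set) \<times> N \<subseteq> UNIV \<times> N'"
    using SN by auto
  moreover have "(UNIV :: real set) \<times> N' \<in> null_sets lborel"
    using SN(3) unfolding lborel_prod[symmetric]
    by (auto simp: null_sets_def lborel.emeasure_pair_measure_Times)
  moreover have "(UNIV :: real set) \<times> S \<in> sets lborel"
    using SN(4) unfolding lborel_prod[symmetric] by auto
  ultimately show ?thesis
    by (rule sets_completionI)
qed

lemma measurable_snd_glt_domain:
  fixes f :: "real \<Rightarrow> complex"
  assumes f: "f \<in> borel_measurable torus"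
  shows "(\<lambda>(x :: real, \<theta>). f \<theta>) \<in> borel_measurable (lebesgue_on glt_domain)"
proof (rule measurableI)
  fix U :: "complex set" assume "U \<in> sets borel"
  then have "f -` U \<inter> space torus \<in> sets torus"
    using f by (rule measurable_sets[rotated])
  then have "f -` U \<inter> {-pi..pi} \<in> sets lebesgue"
    by (simp add: sets_restrict_space_iff space_restrict_space)
  then have "(UNIV :: real set) \<times> (f -` U \<inter> {-pi..pi}) \<in> sets lebesgue"
    by (rule lebesgue_sets_UNIV_Times)
  moreover have domain: "glt_domain \<in> sets lebesgue"
    by (intro lmeasurable_compact[THEN fmeasurableD] compact_Times) auto
  ultimately have "glt_domain \<inter> UNIV \<times> (f -` U \<inter> {-pi..pi}) \<in> sets lebesgue"
    by blast
  moreover have "(\<lambda>(x :: real, \<theta>). f \<theta>) -` U \<inter> space (lebesgue_on glt_domain)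
      = glt_domain \<inter> UNIV \<times> (f -` U \<inter> {-pi..pi})"
    by (auto simp: space_restrict_space)
  ultimately show "(\<lambda>(x :: real, \<theta>). f \<theta>) -` U \<inter> space (lebesgue_on glt_domain) \<in> sets (lebesgue_on glt_domain)"
    using domain by (auto simp: sets_restrict_space_iff)
qed simp

lemma glt_sequence_if_locally_toeplitz:
  assumes "locally_toeplitz A (\<lambda>_. 1) f"
  shows "glt_sequence A (\<lambda>(x, \<theta>). f \<theta>)"
proof -
  have A: "A n \<in> carrier_mat n n" for n
    using assms by (simp add: locally_toeplitz_def)
  have "integrable torus f"
    using assms by (simp add: locally_toeplitz_def absolutely_integrable_on_torus_iff)
  then have "(\<lambda>(x :: real, \<theta>). f \<theta>) \<in> borel_measurable (lebesgue_on glt_domain)"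
    by (intro measurable_snd_glt_domain) simp
  moreover have "acs (\<lambda>m n. mat_sum n (\<lambda>i. A n) {..<Suc 0}) A"
  proof -
    have "mat_sum n (\<lambda>i. A n) {..<Suc 0} = A n" for n
      using A[of n] unfolding mat_sum_def by (intro eq_matI) auto
    then show ?thesis using acs_refl[of A] A by simp
  qed
  moreover have "converges_in_measure_on glt_domain (\<lambda>m (x, \<theta>). \<Sum>i<Suc 0. 1 * f \<theta>) (\<lambda>(x, \<theta>). f \<theta>)"
  proof -
    have "{p \<in> glt_domain. cmod ((case p of (x, \<theta>) \<Rightarrow> \<Sum>i<Suc 0. 1 * f \<theta>) - (case p of (x, \<theta>) \<Rightarrow> f \<theta>)) > \<epsilon>} = {}"
      if "\<epsilon> > 0" for \<epsilon> using that by auto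
    then show ?thesis unfolding converges_in_measure_on_def by simp
  qed
  ultimately show ?thesis
    unfolding glt_sequence_def using A assms
    by (intro conjI exI[of _ "\<lambda>_. Suc 0"] exI[of _ "\<lambda>_ _. A"] exI[of _ "\<lambda>_ _ _. 1"] exI[of _ "\<lambda>_ _. f"]) auto
qed

section \<open>Sequences with a Toeplitz momentary symbol\<close>

text \<open>
  The decay of \<open>c 1, \<dots>, c t\<close> enters twice: it makes the perturbation small in \<open>L\<^sup>1\<close>, which
  gives the GLT property, and small uniformly on every set on which \<open>f 1, \<dots>, f t\<close> are bounded.
\<close>

theorem theorem1:
  fixes t :: nat
    and f :: "nat \<Rightarrow> real \<Rightarrow> complex"
    and c :: "nat \<Rightarrow> nat \<Rightarrow> complex"
    and A :: "nat \<Rightarrow> nat \<Rightarrow> complex mat"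
    and X :: "nat \<Rightarrow> complex mat"
  assumes f_L1: "\<And>j. j \<le> t \<Longrightarrow> f j absolutely_integrable_on {-pi..pi}"
    and c_nonzero: "\<And>j n. j \<le> t \<Longrightarrow> c j n \<noteq> 0"
    and c_0: "\<And>n. c 0 n = 1"
    and c_decay: "\<And>r s. r < s \<Longrightarrow> s \<le> t \<Longrightarrow> c s \<in> o(c r)"
    and A_dim: "\<And>j n. j \<le> t \<Longrightarrow> A j n \<in> carrier_mat n n"
    and A_toeplitz: "\<And>j n. j \<le> t \<Longrightarrow> (1 / c j n) \<cdot>\<^sub>m A j n = toeplitz n (f j)"
    and X_def: "\<And>n. X n = A 0 n + mat_sum n (\<lambda>j. A j n) {1..t}"
  shows "glt_sequence X (\<lambda>(x, \<theta>). f 0 \<theta>) \<and>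
    (\<forall>S \<subseteq> {-pi..pi}. (\<forall>j \<in> {1..t}. bounded (f j ` S)) \<longrightarrow>
       uniform_limit S (toeplitz_momentary_symbol t c f) (f 0) sequentially)"
proof (intro conjI allI impI)
  define h where "h n \<theta> = (\<Sum>j = 1..t. c j n * f j \<theta>)" for n \<theta>
  have int: "integrable torus (f j)" if "j \<le> t" for j
    using f_L1[OF that] by (simp only: absolutely_integrable_on_torus_iff)
  have h_int: "integrable torus (h n)" for n
    unfolding h_def[abs_def] by (intro Bochner_Integration.integrable_sum integrable_mult_right int) auto
  have c_tendsto: "c j \<longlonglongrightarrow> 0" if "j \<in> {1..t}" for j
  proof -
    have "c j \<in> o(\<lambda>_. 1)" using c_decay[of 0 j] that c_0 by (simp add: fun_eq_iff[symmetric] ext[of "c 0" "\<lambda>_. 1"])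
    then show ?thesis by (auto dest: smalloD_tendsto)
  qed
  have h_le: "L1_mean (h n) \<le> (\<Sum>j = 1..t. cmod (c j n) * L1_mean (f j))" for n
  proof -
    have "integral\<^sup>L torus (\<lambda>\<theta>. cmod (h n \<theta>)) \<le> integral\<^sup>L torus (\<lambda>\<theta>. \<Sum>j = 1..t. cmod (c j n) * cmod (f j \<theta>))"
      using h_int[of n] int unfolding h_def
      by (intro integral_mono) (auto simp: norm_mult intro!: order_trans[OF norm_sum])
    also have "\<dots> = (\<Sum>j = 1..t. cmod (c j n) * integral\<^sup>L torus (\<lambda>\<theta>. cmod (f j \<theta>)))"
      using int by (subst Bochner_Integration.integral_sum) auto
    finally show ?thesis
      by (simp add: L1_mean_def sum_divide_distrib[symmetric] divide_right_mono)
  qed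
  have h_tendsto: "(\<lambda>n. L1_mean (h n)) \<longlonglongrightarrow> 0"
  proof (rule tendsto_sandwich)
    show "\<forall>\<^sub>F n in sequentially. 0 \<le> L1_mean (h n)"
      by (simp add: L1_mean_def)
    show "\<forall>\<^sub>F n in sequentially. L1_mean (h n) \<le> (\<Sum>j = 1..t. cmod (c j n) * L1_mean (f j))"
      using h_le by (rule always_eventually[OF allI])
    show "(\<lambda>n. \<Sum>j = 1..t. cmod (c j n) * L1_mean (f j)) \<longlonglongrightarrow> 0"
      using tendsto_norm_zero[OF c_tendsto] by (intro tendsto_null_sum tendsto_mult_left_zero)
  qed simp
  have X_eq: "X n = toeplitz n (\<lambda>\<theta>. f 0 \<theta> + h n \<theta>)" for n
  proof (rule eq_matI)
    have entry: "A j n $$ (r, s) = c j n * fourier_coeff (f j) (int r - int s)"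
      if "j \<le> t" "r < n" "s < n" for j r s
    proof -
      have "((1 / c j n) \<cdot>\<^sub>m A j n) $$ (r, s) = fourier_coeff (f j) (int r - int s)"
        unfolding A_toeplitz[OF that(1)] using that by (simp add: toeplitz_def)
      then show ?thesis using A_dim[OF that(1), of n] c_nonzero[OF that(1), of n] that
        by (auto simp: field_simps)
    qed
    fix r s assume "r < dim_row (toeplitz n (\<lambda>\<theta>. f 0 \<theta> + h n \<theta>))" "s < dim_col (toeplitz n (\<lambda>\<theta>. f 0 \<theta> + h n \<theta>))"
    then have rs: "r < n" "s < n" by (simp_all add: toeplitz_def)
    have "fourier_coeff (h n) k = (\<Sum>j = 1..t. c j n * fourier_coeff (f j) k)" for k
      unfolding h_def[abs_def] using int by (subst fourier_coeff_sum) (auto simp: fourier_coeff_mult)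
    then show "X n $$ (r, s) = toeplitz n (\<lambda>\<theta>. f 0 \<theta> + h n \<theta>) $$ (r, s)"
      using rs A_dim[of 0 n] entry[of _ r s] int[of 0] h_int[of n]
      by (simp add: X_def mat_sum_def toeplitz_def fourier_coeff_add c_0)
  qed (auto simp: X_def mat_sum_def toeplitz_def)
  have "locally_toeplitz X (\<lambda>_. 1) (f 0)"
    unfolding locally_toeplitz_def X_eq[abs_def]
    using acs_lt_operator_toeplitz[OF int[of 0] h_int h_tendsto] f_L1[of 0] riemann_integrable_01_const
    by (auto simp: toeplitz_def)
  then show "glt_sequence X (\<lambda>(x, \<theta>). f 0 \<theta>)"
    by (rule glt_sequence_if_locally_toeplitz)
  fix S :: "real set" assume "S \<subseteq> {-pi..pi}" and bdd: "\<forall>j \<in> {1..t}. bounded (f j ` S)"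
  have "\<forall>j \<in> {1..t}. \<exists>B. \<forall>\<theta>\<in>S. cmod (f j \<theta>) \<le> B"
    using bdd by (auto simp: bounded_iff)
  then obtain B where B: "\<And>j \<theta>. j \<in> {1..t} \<Longrightarrow> \<theta> \<in> S \<Longrightarrow> cmod (f j \<theta>) \<le> B j"
    by metis
  show "uniform_limit S (toeplitz_momentary_symbol t c f) (f 0) sequentially"
  proof (rule uniform_limitI)
    fix e :: real assume "e > 0"
    have "(\<lambda>n. \<Sum>j = 1..t. cmod (c j n) * B j) \<longlonglongrightarrow> 0"
      using tendsto_norm_zero[OF c_tendsto] by (intro tendsto_null_sum tendsto_mult_left_zero)
    then have "\<forall>\<^sub>F n in sequentially. (\<Sum>j = 1..t. cmod (c j n) * B j) < e"
      using \<open>e > 0\<close> by (rule order_tendstoD(2))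
    then show "\<forall>\<^sub>F n in sequentially. \<forall>\<theta>\<in>S. dist (toeplitz_momentary_symbol t c f n \<theta>) (f 0 \<theta>) < e"
    proof eventually_elim
      case (elim n)
      show ?case
      proof
        fix \<theta> assume "\<theta> \<in> S"
        have "dist (toeplitz_momentary_symbol t c f n \<theta>) (f 0 \<theta>) \<le> (\<Sum>j = 1..t. cmod (c j n * f j \<theta>))"
          unfolding toeplitz_momentary_symbol_def dist_norm by (simp add: norm_sum)
        also have "\<dots> \<le> (\<Sum>j = 1..t. cmod (c j n) * B j)"
          using B \<open>\<theta> \<in> S\<close> by (intro sum_mono) (auto simp: norm_mult intro!: mult_left_mono)
        finally show "dist (toeplitz_momentary_symbol t c f n \<theta>) (f 0 \<theta>) < e"
          using elim by simp
      qed
    qed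
  qed
qed

end
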